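(* Assume (H1) and (H2) at the prime $r$. Write $\nu_r=v_r(s_0(s_0-1))$ and let $\Delta$ denote the discriminant of the extension $\mathbb Q_r(\gamma_0)/\mathbb Q_r$. Then $v_r(\Delta)=r$ if $\nu_r=2$; $v_r(\Delta)=\frac{3r-1}{2}$ if $\nu_r=1$; $v_r(\Delta)=r$ if $\nu_r\le0$, $\nu_r\equiv0\pmod r$ and $g_r^-$ is irreducible over $\mathbb Q_r$; and $v_r(\Delta)=2r-1$ if $\nu_r<0$ and $\nu_r\not\equiv0\pmod r$.
   Context: Let $r\ge5$ be prime, $\zeta_r$ a primitive $r$-th root of unity, $\omega_j=\zeta_r^j+\zeta_r^{-j}$; $h_r(x)=\prod_{j=1}^{(r-1)/2}(x-\omega_j)\in\mathbb Z[x]$, $g_{r,s}^-(x)=(-1)^{(r-1)/2}x\,h_r(2-x^2)+2-4s$. Fix $s_0\in\overline{\mathbb Q}\setminus\{0,1\}$ and $\delta_{\mathbb Q}\in\overline{\mathbb Z}\setminus\{0\}$ with $\delta_{\mathbb Q}^2\in\mathbb Z$, $\delta_{\mathbb Q}^r(2-4s_0)\in\mathbb Z$; $g_r^-(x)=\delta_{\mathbb Q}^rg^-_{r,s_0}(x/\delta_{\mathbb Q})\in\mathbb Z[x]$. Fix $\overline{\mathbb Q}\hookrightarrow\overline{\mathbb Q}_r$, $v_r$ with $v_r(r)=1$. Choose square roots $\sqrt{s_0},\sqrt{s_0-1}$, $\sqrt{s_0(s_0-1)}=\sqrt{s_0}\sqrt{s_0-1}$, let $\alpha_0$ be an $r$-th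 root of $2s_0-1+2\sqrt{s_0(s_0-1)}$, and $\gamma_0=\delta_{\mathbb Q}(\alpha_0+\alpha_0^{-1})$, a root of $g_r^-$. (H1) at $r$: if $v_r(s_0(s_0-1))\ge0$ then $v_r(\delta_{\mathbb Q})=0$ and $v_r(2-4s_0)\in\mathbb Z$. (H2) at $r$: if $v_r(s_0(s_0-1))\le0$ and $\equiv0\pmod r$ then $v_r(\delta_{\mathbb Q}^{2r}s_0(s_0-1))=0$. *)

theory Defs
  imports
    "HOL-Algebra.Algebraic_Closure_Type"
    "HOL-Algebra.Generated_Fields"
    "HOL-Library.Extended_Real"
    "Jordan_Normal_Form.Determinant"
begin

subsection \<open>Valued fields and \<open>p\<close>-adic numbers\<close>

definition valuation :: "('a::field \<Rightarrow> ereal) \<Rightarrow> bool" where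
  "valuation v \<longleftrightarrow>
     (\<forall>x. v x = \<infinity> \<longleftrightarrow> x = 0) \<and> (\<forall>x. v x \<noteq> -\<infinity>) \<and>
     (\<forall>x y. v (x * y) = v x + v y) \<and> (\<forall>x y. min (v x) (v y) \<le> v (x + y))"

text \<open>
  A type \<open>'k\<close> with a valuation \<open>w\<close> is the field of \<open>p\<close>-adic numbers if it is the completion of the
  rationals at \<open>p\<close>: it is complete, the rationals are dense in it, and \<open>w p = 1\<close>. For a prime \<open>p\<close>
  the last condition forces \<open>w\<close> to be the \<open>p\<close>-adic valuation on the rationals, because the integers
  of positive valuation form a prime ideal. These conditions determine \<open>('k, w)\<close> up to a unique
  isomorphism.
\<close>

definition padic_numbers :: "nat \<Rightarrow> ('k::field_char_0 \<Rightarrow> ereal) \<Rightarrow> bool" where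
  "padic_numbers p w \<longleftrightarrow>
     valuation w \<and> w (of_nat p) = 1 \<and>
     (\<forall>x. \<forall>N::real. \<exists>q::rat. ereal N \<le> w (x - of_rat q)) \<and>
     (\<forall>s::nat \<Rightarrow> 'k.
        (\<forall>N::real. \<exists>M. \<forall>m\<ge>M. \<forall>n\<ge>M. ereal N \<le> w (s m - s n)) \<longrightarrow>
        (\<exists>l. \<forall>N::real. \<exists>M. \<forall>n\<ge>M. ereal N \<le> w (s n - l)))"

subsection \<open>Finite extensions inside the algebraic closure and their discriminant\<close>

global_interpretation ac_vs: vector_space "\<lambda>(c::'k::field) (x::'k alg_closure). to_ac c * x"
  by unfold_locales (simp_all add: algebra_simps)

definition simple_extension :: "'k::field alg_closure \<Rightarrow> 'k alg_closure set" where
  "simple_extension x = generate_field ring_of_type_algebra (range to_ac \<union> {x})"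

text \<open>
  The trace of the multiplication map \<open>y \<mapsto> x * y\<close> on \<open>F\<close>, viewed as a vector space over the base
  field. It does not depend on the basis when \<open>F\<close> is of finite degree.
\<close>

definition field_trace :: "'k::field alg_closure set \<Rightarrow> 'k alg_closure \<Rightarrow> 'k" where
  "field_trace F x =
     (let B = SOME B. ac_vs.independent B \<and> ac_vs.span B = F
      in \<Sum>b\<in>B. ac_vs.representation B (x * b) b)"

text \<open>
  \<open>bs\<close> is a basis of the ring of integers of \<open>F\<close> as a module over the ring of integers of the base
  field. Linear independence over a domain and over its fraction field are the same thing.
\<close>

definition integral_basis ::
    "('k::field alg_closure \<Rightarrow> ereal) \<Rightarrow> 'k alg_closure set \<Rightarrow> 'k alg_closure list \<Rightarrow> bool" where
  "integral_basis v F bs \<longleftrightarrow>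
     distinct bs \<and> ac_vs.independent (set bs) \<and>
     {x \<in> F. 0 \<le> v x} =
       {\<Sum>i<length bs. to_ac (c i) * bs ! i | c. \<forall>i<length bs. 0 \<le> v (to_ac (c i))}"

definition basis_discriminant :: "'k::field alg_closure set \<Rightarrow> 'k alg_closure list \<Rightarrow> 'k" where
  "basis_discriminant F bs =
     det (mat (length bs) (length bs) (\<lambda>(i, j). field_trace F (bs ! i * bs ! j)))"

text \<open>
  The discriminant is only determined up to the square of a unit; its valuation is well defined.
\<close>

definition discriminant :: "('k::field alg_closure \<Rightarrow> ereal) \<Rightarrow> 'k alg_closure set \<Rightarrow> 'k" where
  "discriminant v F = basis_discriminant F (SOME bs. integral_basis v F bs)"

subsection \<open>The polynomials\<close>

definition h_poly :: "nat \<Rightarrow> 'a::field \<Rightarrow> 'a poly" where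
  "h_poly r \<zeta> = (\<Prod>j=1..(r - 1) div 2. [:- (\<zeta> ^ j + inverse (\<zeta> ^ j)), 1:])"

definition g_minus_s :: "nat \<Rightarrow> 'a::field \<Rightarrow> 'a \<Rightarrow> 'a poly" where
  "g_minus_s r \<zeta> s =
     smult ((-1) ^ ((r - 1) div 2)) ([:0, 1:] * pcompose (h_poly r \<zeta>) [:2, 0, -1:]) + [:2 - 4 * s:]"

text \<open>
  The polynomial \<open>\<delta>\<^sup>r g(x / \<delta>)\<close> has integer coefficients in the situation of interest;
  \<open>g_minus\<close> is that integer polynomial.
\<close>

definition g_minus :: "nat \<Rightarrow> 'a::field_char_0 \<Rightarrow> 'a \<Rightarrow> 'a \<Rightarrow> int poly" where
  "g_minus r \<zeta> \<delta> s =
     (THE G. map_poly of_int G = smult (\<delta> ^ r) (pcompose (g_minus_s r \<zeta> s) [:0, 1 / \<delta>:]))"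

end

theory Submission
  imports
    Defs
    "Jordan_Normal_Form.Char_Poly"
    "HOL-Number_Theory.Number_Theory"
begin

text \<open>
  Put \<open>u = \<delta>\<^sup>2\<close> and \<open>c = \<delta>\<^sup>r (2 - 4 s\<^sub>0)\<close>, both rational integers. Then \<open>g\<^sub>r\<^sup>-\<close> is \<open>D\<^sub>r(X, u) + c\<close> for the
  Dickson polynomial \<open>D\<^sub>r\<close>, with roots \<open>\<gamma>\<^sub>i = \<delta> (\<zeta>\<^sup>i \<alpha>\<^sub>0 + \<zeta>\<^sup>-\<^sup>i \<alpha>\<^sub>0\<^sup>-\<^sup>1)\<close>. From \<open>D\<^sub>r' = r E\<close>, with \<open>E\<close> the Dickson
  polynomial of the second kind of index \<open>r - 1\<close>, the discriminant of this polynomial has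
  valuation \<open>r + (r - 1) (r v(\<delta>) + \<nu> / 2)\<close>.

  In each case some translate \<open>\<theta> = \<gamma>\<^sub>0 + b\<close> with \<open>b\<close> in \<open>\<rat>\<^sub>r\<close> has valuation \<open>m / r\<close> with \<open>m\<close> prime to \<open>r\<close>:
  \<open>m = \<nu>\<close> if \<open>\<nu>\<close> is 1 or 2, \<open>m = v(c)\<close> if \<open>\<nu> < 0\<close> is not divisible by \<open>r\<close>, and \<open>m = 1\<close> in the remaining
  case, where otherwise a Hensel argument would give a root of \<open>g\<^sub>r\<^sup>-\<close> in \<open>\<rat>\<^sub>r\<close>. The powers
  \<open>1, \<theta>, \<dots>, \<theta>\<^sup>r\<^sup>-\<^sup>1\<close> then have valuations that are distinct modulo 1, so dividing \<open>\<theta>\<^sup>k\<close> by \<open>r\<close> to the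
  power \<open>\<lfloor>k m / r\<rfloor>\<close> gives an integral basis. Hence the valuation of the discriminant drops by
  \<open>2 \<Sum>\<^sub>k \<lfloor>k m / r\<rfloor> = (m - 1) (r - 1)\<close>.
\<close>

subsection \<open>Valuations\<close>

locale valued =
  fixes v :: "'a::field \<Rightarrow> ereal"
  assumes valuation: "valuation v"
begin

lemma v_eq_infinity_iff [simp]: "v x = \<infinity> \<longleftrightarrow> x = 0"
  using valuation by (auto simp: valuation_def)

lemma v_0 [simp]: "v 0 = \<infinity>"
  by simp

lemma v_neq_minus_infinity [simp]: "v x \<noteq> -\<infinity>"
  using valuation by (auto simp: valuation_def)

lemma v_mult: "v (x * y) = v x + v y"
  using valuation by (auto simp: valuation_def)

lemma v_add_min: "min (v x) (v y) \<le> v (x + y)"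
  using valuation by (auto simp: valuation_def)

lemma v_real:
  assumes "x \<noteq> 0"
  obtains a where "v x = ereal a"
  using assms v_eq_infinity_iff[of x] v_neq_minus_infinity[of x] by (cases "v x") auto

lemma v_1 [simp]: "v 1 = 0"
proof -
  obtain a where a: "v 1 = ereal a" using v_real[of 1] by auto
  show ?thesis using v_mult[of 1 1] a by (simp add: zero_ereal_def)
qed

lemma v_minus [simp]: "v (- x) = v x"
proof -
  obtain a where a: "v (-1) = ereal a" using v_real[of "-1"] by auto
  have "v (-1) = 0" using v_mult[of "-1" "-1"] a by (simp add: zero_ereal_def)
  then show ?thesis using v_mult[of "-1" x] by simp
qed

lemma v_diff_commute: "v (x - y) = v (y - x)"
  using v_minus[of "x - y"] by simp

lemma v_add_ge: "a \<le> v x \<Longrightarrow> a \<le> v y \<Longrightarrow> a \<le> v (x + y)"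
  using v_add_min[of x y] by (meson min.boundedI order_trans)

lemma v_diff_ge: "a \<le> v x \<Longrightarrow> a \<le> v y \<Longrightarrow> a \<le> v (x - y)"
  using v_add_ge[of a x "-y"] by simp

lemma v_add_gt: "a < v x \<Longrightarrow> a < v y \<Longrightarrow> a < v (x + y)"
  using v_add_min[of x y] by (meson min_less_iff_conj order_less_le_trans)

lemma v_add_eq:
  assumes "v x < v y"
  shows "v (x + y) = v x"
proof (rule antisym)
  show "v x \<le> v (x + y)"
    using v_add_ge[of "v x" x y] assms by simp
  show "v (x + y) \<le> v x"
  proof (rule ccontr)
    assume "\<not> v (x + y) \<le> v x"
    then have "v x < v (x + y)" by simp
    then have "v x < v (x + y - y)"
      using v_add_gt[of "v x" "x + y" "- y"] assms by simp
    then show False by simp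
  qed
qed

lemma v_power: "v (x ^ n) = ereal (real n) * v x"
proof (cases "x = 0")
  case True
  then show ?thesis by (cases n) (auto simp: zero_ereal_def)
next
  case False
  then obtain a where "v x = ereal a" using v_real by blast
  then show ?thesis
    by (induction n) (auto simp: v_mult algebra_simps zero_ereal_def)
qed

lemma v_inverse:
  assumes "x \<noteq> 0"
  shows "v (inverse x) = - v x"
proof -
  obtain a where a: "v x = ereal a" using v_real assms by blast
  obtain b where b: "v (inverse x) = ereal b" using v_real[of "inverse x"] assms by auto
  have "v (x * inverse x) = 0" using assms by simp
  then have "a + b = 0" using a b by (simp only: v_mult) simp
  then show ?thesis using a b by simp
qed

lemma v_divide: "y \<noteq> 0 \<Longrightarrow> v (x / y) = v x - v y"
  by (simp add: divide_inverse v_mult v_inverse minus_ereal_def)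

lemma v_prod: "v (\<Prod>i\<in>A. f i) = (\<Sum>i\<in>A. v (f i))"
  by (induction A rule: infinite_finite_induct) (auto simp: v_mult)

lemma v_sum_ge: "(\<And>i. i \<in> A \<Longrightarrow> a \<le> v (f i)) \<Longrightarrow> a \<le> v (\<Sum>i\<in>A. f i)"
  by (induction A rule: infinite_finite_induct) (auto intro: v_add_ge)

lemma v_sum_gt: "a < \<infinity> \<Longrightarrow> (\<And>i. i \<in> A \<Longrightarrow> a < v (f i)) \<Longrightarrow> a < v (\<Sum>i\<in>A. f i)"
  by (induction A rule: infinite_finite_induct) (auto intro: v_add_gt)

text \<open>A nonzero summand shares its valuation with no other one, so a summand of least
  valuation strictly beats the rest and fixes the valuation of the sum. Zero summands are exempt in
  \<open>dist\<close> because they all have valuation infinity.\<close>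

lemma v_sum_le_of_distinct:
  assumes "finite A" and "i \<in> A"
    and dist: "\<And>i j. i \<in> A \<Longrightarrow> j \<in> A \<Longrightarrow> i \<noteq> j \<Longrightarrow> f i \<noteq> 0 \<Longrightarrow> v (f i) \<noteq> v (f j)"
  shows "v (\<Sum>i\<in>A. f i) \<le> v (f i)"
proof (cases "\<forall>i\<in>A. f i = 0")
  case True
  then show ?thesis using assms by simp
next
  case False
  define j where "j = arg_min_on (\<lambda>i. v (f i)) A"
  have j: "j \<in> A" "\<And>i. i \<in> A \<Longrightarrow> v (f j) \<le> v (f i)"
    unfolding j_def using assms arg_min_if_finite[of A "\<lambda>i. v (f i)"] by (auto simp: not_less)
  have nz: "f j \<noteq> 0" using False j by fastforce
  have "v (f j) < v (\<Sum>i\<in>A - {j}. f i)"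
  proof (rule v_sum_gt)
    show "v (f j) < \<infinity>" using nz by (metis ereal_infty_less(1) v_eq_infinity_iff)
    show "v (f j) < v (f i)" if "i \<in> A - {j}" for i
      using that j dist[of j i] nz by (metis DiffE insertI1 order_le_imp_less_or_eq)
  qed
  then have "v (f j + (\<Sum>i\<in>A - {j}. f i)) = v (f j)" by (rule v_add_eq)
  then show ?thesis using j assms by (simp add: sum.remove[of A j])
qed

lemma v_of_nat_ge: "0 \<le> v (of_nat n)"
  by (induction n) (auto intro: v_add_ge)

lemma v_of_int_ge: "0 \<le> v (of_int n)"
  by (cases n rule: int_cases2) (auto simp: v_of_nat_ge)

lemma v_mult_ge: "0 \<le> v x \<Longrightarrow> 0 \<le> v y \<Longrightarrow> 0 \<le> v (x * y)"
  by (simp add: v_mult)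

lemma v_power_ge: "0 \<le> v x \<Longrightarrow> 0 \<le> v (x ^ n)"
  by (simp add: v_power)

lemma v_prod_ge: "(\<And>i. i \<in> A \<Longrightarrow> 0 \<le> v (f i)) \<Longrightarrow> 0 \<le> v (\<Prod>i\<in>A. f i)"
  by (simp add: v_prod sum_nonneg)

lemma v_poly_of_int_ge:
  assumes "0 \<le> v x"
  shows "0 \<le> v (poly (map_poly of_int p) x)"
  unfolding poly_altdef using assms
  by (intro v_sum_ge v_mult_ge v_power_ge) (auto simp: coeff_map_poly v_of_int_ge)

lemma v_of_power_eq:
  assumes "n > 0" "v (x ^ n) = ereal a"
  shows "v x = ereal (a / real n)"
proof -
  have "x \<noteq> 0" using assms by (metis PInfty_neq_ereal(1) v_0 zero_power)
  then obtain b where "v x = ereal b" using v_real by blast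
  then show ?thesis using assms by (simp add: v_power field_simps)
qed

lemma v_of_power_ge:
  assumes "n > 0" "0 \<le> v (x ^ n)"
  shows "0 \<le> v x"
proof (cases "x = 0")
  case False
  then obtain b where "v x = ereal b" using v_real by blast
  then show ?thesis using assms by (simp add: v_power zero_le_mult_iff)
qed simp

end

subsection \<open>Separable simple extensions and traces\<close>

interpretation to_ac: field_hom to_ac
  by unfold_locales auto

interpretation to_ac_poly: map_poly_inj_idom_hom to_ac ..


section \<open>The Vandermonde determinant\<close>

lemma coeff_newton_poly:
  fixes x :: "nat \<Rightarrow> 'a :: comm_ring_1"
  shows "degree (\<Prod>l<k. [:- x l, 1:]) \<le> k" "coeff (\<Prod>l<k. [:- x l, 1:]) k = 1"
proof -
  have "degree (\<Prod>l<k. [:- x l, 1:]) \<le> k \<and> coeff (\<Prod>l<k. [:- x l, 1:]) k = 1"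
  proof (induction k)
    case (Suc k)
    have "degree ((\<Prod>l<k. [:- x l, 1:]) * [:- x k, 1:]) \<le> k + 1"
      using Suc by (intro order.trans[OF degree_mult_le] add_mono) auto
    moreover have "coeff ((\<Prod>l<k. [:- x l, 1:]) * [:- x k, 1:]) (Suc k) = 1"
      using Suc by (simp add: coeff_eq_0 algebra_simps)
    ultimately show ?case by simp
  qed simp
  then show "degree (\<Prod>l<k. [:- x l, 1:]) \<le> k" "coeff (\<Prod>l<k. [:- x l, 1:]) k = 1"
    by auto
qed

text \<open>Multiplying by the unitriangular coefficient matrix of the Newton polynomials
  makes the Vandermonde matrix triangular.\<close>

lemma det_vandermonde:
  fixes x :: "nat \<Rightarrow> 'a :: idom"
  shows "det (mat n n (\<lambda>(i, j). x i ^ j)) = (\<Prod>i<n. \<Prod>j<i. x i - x j)"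
proof -
  define N where "N k = (\<Prod>l<k. [:- x l, 1:])" for k
  have N: "degree (N k) \<le> k" "coeff (N k) k = 1" for k
    unfolding N_def by (rule coeff_newton_poly)+
  have N_eval: "poly (N k) y = (\<Prod>l<k. y - x l)" for k y
    by (simp add: N_def poly_prod)
  define V where "V = mat n n (\<lambda>(i, j). x i ^ j)"
  define U where "U = mat n n (\<lambda>(j, k). coeff (N k) j)"
  have carr: "V \<in> carrier_mat n n" "U \<in> carrier_mat n n"
    by (simp_all add: V_def U_def)
  have "det U = prod_list (diag_mat U)"
    using carr(2)
  proof (rule det_upper_triangular[rotated])
    show "upper_triangular U"
      using N(1) by (auto simp: U_def upper_triangular_def intro!: coeff_eq_0)
        (meson le_less_trans)
  qed
  also have "diag_mat U = map (\<lambda>i. 1) [0..<n]"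
    using N(2) by (auto simp: diag_mat_def U_def)
  finally have detU: "det U = 1"
    by (simp add: prod.distinct_set_conv_list[symmetric])
  have VU: "(V * U) $$ (i, k) = (\<Prod>l<k. x i - x l)" if "i < n" "k < n" for i k
  proof -
    have "(V * U) $$ (i, k) = (\<Sum>j<n. x i ^ j * coeff (N k) j)"
      using that by (simp add: V_def U_def scalar_prod_def atLeast0LessThan)
    also have "\<dots> = poly (N k) (x i)"
      unfolding poly_altdef using that N(1)[of k]
      by (intro sum.mono_neutral_cong_right) (auto simp: coeff_eq_0)
    finally show ?thesis by (simp add: N_eval)
  qed
  \<comment> \<open>For \<open>i < k\<close> the entry of \<open>V * U\<close> contains the factor
    \<open>x i - x i\<close>, so this product is lower triangular; transposing makes
    \<open>det_upper_triangular\<close> applicable.\<close>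
  define M where "M = (V * U)\<^sup>T"
  have M: "M \<in> carrier_mat n n" "\<And>i k. i < n \<Longrightarrow> k < n \<Longrightarrow> M $$ (k, i) = (\<Prod>l<k. x i - x l)"
    using carr VU by (auto simp: M_def simp del: index_mult_mat(1))
  have "det M = prod_list (diag_mat M)"
  proof (rule det_upper_triangular)
    show "upper_triangular M"
      using M by (auto simp: upper_triangular_def intro!: prod_zero)
  qed (use M in auto)
  also have "diag_mat M = map (\<lambda>i. \<Prod>l<i. x i - x l) [0..<n]"
    using M by (auto simp: diag_mat_def)
  also have "prod_list \<dots> = (\<Prod>i<n. \<Prod>l<i. x i - x l)"
    by (simp add: prod.distinct_set_conv_list[symmetric] atLeast0LessThan)
  also have "det M = det V * det U"
    using carr by (simp add: M_def det_transpose[of _ n] det_mult[of _ n])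
  finally show ?thesis by (simp add: detU V_def)
qed

text \<open>The conjugates \<open>x i\<close> of \<open>x 0\<close> are given as the roots of an annihilating polynomial \<open>P\<close>
  of degree \<open>n\<close>, which is minimal by the last assumption.\<close>

locale separable_element =
  fixes n :: nat and x :: "nat \<Rightarrow> 'k::field alg_closure" and P :: "'k poly"
  assumes n_pos: "n > 0"
    and degree_P: "degree P = n"
    and roots: "\<And>i. i < n \<Longrightarrow> poly (map_poly to_ac P) (x i) = 0"
    and inj_x: "inj_on x {..<n}"
    and minimal: "\<And>p. degree p < n \<Longrightarrow> poly (map_poly to_ac p) (x 0) = 0 \<Longrightarrow> p = 0"
begin

abbreviation ev :: "'k poly \<Rightarrow> 'k alg_closure \<Rightarrow> 'k alg_closure" where
  "ev p y \<equiv> poly (map_poly to_ac p) y"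

abbreviation F :: "'k alg_closure set" where
  "F \<equiv> simple_extension (x 0)"

lemma ev_simps:
  "ev (p + q) y = ev p y + ev q y" "ev (p - q) y = ev p y - ev q y" "ev (p * q) y = ev p y * ev q y"
  "ev (smult c p) y = to_ac c * ev p y" "ev (p ^ k) y = ev p y ^ k" "ev 1 y = 1" "ev [:0,1:] y = y"
  "ev [:c:] y = to_ac c" "ev (- p) y = - ev p y" "ev (monom c k) y = to_ac c * y ^ k"
  by (simp_all add: hom_distribs poly_monom)

lemma ev_mod: "i < n \<Longrightarrow> ev (p mod P) (x i) = ev p (x i)"
proof -
  assume "i < n"
  have "ev p (x i) = ev (p div P * P + p mod P) (x i)" by simp
  also have "\<dots> = ev (p mod P) (x i)"
    using roots[OF \<open>i < n\<close>] by (simp only: ev_simps) simp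
  finally show ?thesis ..
qed

lemma degree_mod: "degree (p mod P) < n"
  using degree_mod_less[of P p] degree_P n_pos by (cases "p mod P = 0"; cases "P = 0") auto

text \<open>By minimality the remainder of \<open>p\<close> modulo \<open>P\<close> is zero, so
  \<open>p\<close> is a multiple of \<open>P\<close> and vanishes at every root of
  \<open>P\<close>.\<close>

lemma ev_conjugate_eq_0:
  assumes "ev p (x 0) = 0" "i < n"
  shows "ev p (x i) = 0"
proof -
  have "p mod P = 0" using minimal[OF degree_mod] assms ev_mod[of 0 p] n_pos by simp
  then show ?thesis using ev_mod[of i p] assms by simp
qed

lemma simple_extension_eq: "F = range (\<lambda>p. ev p (x 0))"
proof
  interpret L: Ring.field "ring_of_type_algebra :: 'k alg_closure ring"
    by (rule field_from_type_algebra)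
  let ?R = "ring_of_type_algebra :: 'k alg_closure ring"
  have add: "a \<oplus>\<^bsub>?R\<^esub> b = a + b" and mult: "a \<otimes>\<^bsub>?R\<^esub> b = a * b" and zero: "\<zero>\<^bsub>?R\<^esub> = 0"
    and one: "\<one>\<^bsub>?R\<^esub> = 1" and carr: "carrier ?R = UNIV" for a b
    by (simp_all add: ring_of_type_algebra_def)
  have uminus: "\<ominus>\<^bsub>?R\<^esub> a = - a" for a
    by (rule L.minus_equality) (simp_all add: add zero carr)
  have inv: "inv\<^bsub>?R\<^esub> a = inverse a" if "a \<noteq> 0" for a
    by (rule L.inv_unique'[symmetric]) (use that in \<open>simp_all add: mult one carr\<close>)
  show "F \<subseteq> range (\<lambda>p. ev p (x 0))"
  proof
    fix y assume "y \<in> F"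
    then show "y \<in> range (\<lambda>p. ev p (x 0))"
      unfolding simple_extension_def
    proof (induction rule: generate_field.induct)
      case one
      have "1 = ev 1 (x 0)" by (simp only: ev_simps)
      then show ?case unfolding \<open>\<one>\<^bsub>?R\<^esub> = 1\<close> by (rule range_eqI)
    next
      case (incl h)
      then show ?case
      proof
        assume "h \<in> range to_ac"
        then obtain c where "h = ev [:c:] (x 0)" by (auto simp: ev_simps)
        then show ?thesis by blast
      next
        assume "h \<in> {x 0}"
        then have "h = ev [:0,1:] (x 0)" by (simp only: ev_simps) simp
        then show ?thesis by blast
      qed
    next
      case (a_inv h)
      then obtain p where "h = ev p (x 0)" by blast
      then have "\<ominus>\<^bsub>?R\<^esub> h = ev (- p) (x 0)" by (simp only: uminus ev_simps)
      then show ?case by blast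
    next
      case (m_inv h)
      then obtain p where p: "h = ev p (x 0)" by blast
      have h: "h \<noteq> 0" using m_inv by (simp add: zero)
      \<comment> \<open>The inverse of \<open>h\<close> is a polynomial in \<open>h\<close>: an
        annihilating polynomial, stripped of its powers of X, has constant term \<open>c\<close>
        different from 0, and then c + h q2(h) = 0 can be solved for 1/h.\<close>
      obtain q where q: "q \<noteq> 0" "ev q h = 0" by (rule alg_closure_algebraic)
      define k where "k = order 0 q"
      obtain q' where q': "q = [:0,1:] ^ k * q'" "poly q' 0 \<noteq> 0"
        using order_decomp[OF q(1), of 0] unfolding k_def
        by (metis dvdI dvd_iff_poly_eq_0 minus_zero poly_eq_0_iff_dvd)
      have "ev q' h = 0" using q(2) h by (simp add: q'(1) ev_simps)
      obtain c q2 where c: "q' = pCons c q2" by (cases q')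
      have c0: "c \<noteq> 0" using q'(2) c by simp
      have "to_ac c + h * ev q2 h = 0"
        using \<open>ev q' h = 0\<close> by (simp add: c hom_distribs)
      then have "h * (- ev q2 h / to_ac c) = 1" using c0 by (simp add: field_simps neg_eq_iff_add_eq_0 add.commute)
      then have "inverse h = - ev q2 h / to_ac c" by (rule inverse_unique)
      also have "\<dots> = ev (smult (- inverse c) (q2 \<circ>\<^sub>p p)) (x 0)"
        by (simp add: p hom_distribs poly_pcompose field_simps)
      finally show ?case using inv[OF h] by auto
    next
      case (eng_add h1 h2)
      then obtain p q where "h1 = ev p (x 0)" "h2 = ev q (x 0)" by blast
      then have "h1 \<oplus>\<^bsub>?R\<^esub> h2 = ev (p + q) (x 0)" by (simp only: add ev_simps)
      then show ?case by blast
    next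
      case (eng_mult h1 h2)
      then obtain p q where "h1 = ev p (x 0)" "h2 = ev q (x 0)" by blast
      then have "h1 \<otimes>\<^bsub>?R\<^esub> h2 = ev (p * q) (x 0)" by (simp only: mult ev_simps)
      then show ?case by blast
    qed
  qed
  have to_ac: "to_ac c \<in> F" for c
    unfolding simple_extension_def by (rule generate_field.incl) simp
  have x0: "x 0 \<in> F"
    unfolding simple_extension_def by (rule generate_field.incl) simp
  have F_add: "a + b \<in> F" if "a \<in> F" "b \<in> F" for a b
    using generate_field.eng_add[OF that[unfolded simple_extension_def]]
    by (simp add: simple_extension_def add)
  have F_mult: "a * b \<in> F" if "a \<in> F" "b \<in> F" for a b
    using generate_field.eng_mult[OF that[unfolded simple_extension_def]]
    by (simp add: simple_extension_def mult)
  show "range (\<lambda>p. ev p (x 0)) \<subseteq> F"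
  proof (rule image_subsetI)
    fix p show "ev p (x 0) \<in> F"
      using to_ac[of 0] by (induction p) (auto simp: hom_distribs intro!: F_add F_mult to_ac x0)
  qed
qed

lemma F_E:
  assumes "y \<in> F"
  obtains p where "y = ev p (x 0)" "degree p < n"
proof -
  obtain q where "y = ev q (x 0)" using assms by (auto simp: simple_extension_eq)
  then show ?thesis using that[of "q mod P"] ev_mod[of 0 q] n_pos degree_mod by simp
qed

lemma ev_in_F [simp]: "ev p (x 0) \<in> F"
  by (auto simp: simple_extension_eq)

text \<open>This is the embedding of \<open>F\<close> over the base field that sends
  \<open>x 0\<close> to \<open>x i\<close>. For \<open>i < n\<close> the choice of \<open>p\<close>
  is immaterial by \<open>ev_conjugate_eq_0\<close>.\<close>

definition conj :: "nat \<Rightarrow> 'k alg_closure \<Rightarrow> 'k alg_closure" where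
  "conj i y = ev (SOME p. ev p (x 0) = y) (x i)"

lemma conj_ev: "i < n \<Longrightarrow> conj i (ev p (x 0)) = ev p (x i)"
proof -
  assume "i < n"
  define q where "q = (SOME q. ev q (x 0) = ev p (x 0))"
  have "ev q (x 0) = ev p (x 0)" unfolding q_def by (rule someI) simp
  then have "ev (q - p) (x 0) = 0" by (simp add: ev_simps)
  then have "ev (q - p) (x i) = 0" using ev_conjugate_eq_0 \<open>i < n\<close> by blast
  then show ?thesis by (simp add: conj_def q_def ev_simps)
qed

lemma x0_in_F: "x 0 \<in> F"
  using ev_in_F[of "[:0, 1:]"] by (simp only: ev_simps)

lemma to_ac_in_F: "to_ac c \<in> F"
  using ev_in_F[of "[:c:]"] by (simp only: ev_simps)

lemma F_add: "a \<in> F \<Longrightarrow> b \<in> F \<Longrightarrow> a + b \<in> F"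
  unfolding simple_extension_eq by (auto simp flip: ev_simps)

lemma F_mult: "a \<in> F \<Longrightarrow> b \<in> F \<Longrightarrow> a * b \<in> F"
  unfolding simple_extension_eq by (auto simp flip: ev_simps)

lemma F_power: "a \<in> F \<Longrightarrow> a ^ k \<in> F"
  using to_ac_in_F[of 1] by (induction k) (auto intro: F_mult)

lemma F_sum: "(\<And>i. i \<in> A \<Longrightarrow> f i \<in> F) \<Longrightarrow> (\<Sum>i\<in>A. f i) \<in> F"
  using to_ac_in_F[of 0] by (induction A rule: infinite_finite_induct) (auto intro: F_add)

lemma conj_add: "i < n \<Longrightarrow> a \<in> F \<Longrightarrow> b \<in> F \<Longrightarrow> conj i (a + b) = conj i a + conj i b"
  unfolding simple_extension_eq by (auto simp: conj_ev simp flip: ev_simps)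

lemma conj_mult: "i < n \<Longrightarrow> a \<in> F \<Longrightarrow> b \<in> F \<Longrightarrow> conj i (a * b) = conj i a * conj i b"
  unfolding simple_extension_eq by (auto simp: conj_ev simp flip: ev_simps)

lemma conj_to_ac: "i < n \<Longrightarrow> conj i (to_ac c) = to_ac c"
  using conj_ev[of i "[:c:]"] by (simp add: ev_simps)

lemma conj_x0: "i < n \<Longrightarrow> conj i (x 0) = x i"
  using conj_ev[of i "[:0,1:]"] by (simp only: ev_simps)

lemma conj_power: "i < n \<Longrightarrow> a \<in> F \<Longrightarrow> conj i (a ^ k) = conj i a ^ k"
  using conj_to_ac[of i 1] by (induction k) (auto simp: conj_mult F_power)

lemma conj_sum:
  assumes "i < n" "\<And>j. j \<in> A \<Longrightarrow> f j \<in> F"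
  shows "conj i (\<Sum>j\<in>A. f j) = (\<Sum>j\<in>A. conj i (f j))"
  using assms(2) conj_to_ac[OF assms(1), of 0]
  by (induction A rule: infinite_finite_induct) (auto simp: conj_add F_sum assms(1))


text \<open>Combining the relations for all \<open>k\<close> gives a relation for the values of any
  polynomial at the \<open>x l\<close>; a polynomial that vanishes at all of them except
  \<open>x m\<close> isolates \<open>c m\<close>.\<close>

lemma power_sums_independent:
  assumes "\<And>k. (\<Sum>l<n. c l * x l ^ k) = 0" "m < n"
  shows "c m = 0"
proof -
  have "(\<Sum>l<n. c l * poly q (x l)) = 0" for q
  proof -
    have "(\<Sum>l<n. c l * poly q (x l)) = (\<Sum>l<n. \<Sum>i\<le>degree q. coeff q i * (c l * x l ^ i))"
      by (simp add: poly_altdef sum_distrib_left mult_ac)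
    also have "\<dots> = (\<Sum>i\<le>degree q. coeff q i * (\<Sum>l<n. c l * x l ^ i))"
      by (subst sum.swap) (simp add: sum_distrib_left)
    finally show ?thesis by (simp add: assms)
  qed
  then have "0 = (\<Sum>l<n. c l * poly (\<Prod>j\<in>{..<n}-{m}. [:- x j, 1:]) (x l))"
    by simp
  also have "\<dots> = (\<Sum>l<n. if l = m then c m * (\<Prod>j\<in>{..<n}-{m}. x m - x j) else 0)"
    using assms(2) by (intro sum.cong) (auto simp: poly_prod intro!: prod_zero)
  also have "\<dots> = c m * (\<Prod>j\<in>{..<n}-{m}. x m - x j)"
    using assms(2) by simp
  finally show ?thesis
    using inj_x assms(2) by (auto simp: inj_on_def)
qed

text \<open>Lagrange interpolation at the \<open>n\<close> conjugates recovers \<open>p\<close> from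
  its values there, and \<open>W k l\<close> is the coefficient of index \<open>k\<close> of the
  Lagrange polynomial \<Lambda> of node \<open>l\<close>. It makes coordinates in the power basis
  linear in the conjugates.\<close>

lemma coeff_eq_sum_conjugates:
  obtains W where "\<And>p k. degree p < n \<Longrightarrow> to_ac (coeff p k) = (\<Sum>l<n. W k l * ev p (x l))"
proof
  define D where "D l = (\<Prod>j\<in>{..<n}-{l}. x l - x j)" for l
  define \<Lambda> where "\<Lambda> l = smult (inverse (D l)) (\<Prod>j\<in>{..<n}-{l}. [:- x j, 1:])" for l
  fix p :: "'k poly" and k assume p: "degree p < n"
  have eval: "poly (\<Lambda> l) (x m) = (if l = m then 1 else 0)" if "l < n" "m < n" for l m
  proof -
    have "D l \<noteq> 0" using that inj_x by (auto simp: D_def inj_on_def)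
    then show ?thesis using that by (auto simp: \<Lambda>_def poly_prod simp flip: D_def)
  qed
  have deg: "degree (\<Lambda> l) < n" if "l < n" for l
  proof -
    have "degree (\<Lambda> l) \<le> degree (\<Prod>j\<in>{..<n}-{l}. [:- x j, 1:])"
      by (simp add: \<Lambda>_def degree_smult_le)
    also have "\<dots> \<le> (\<Sum>j\<in>{..<n}-{l}. degree [:- x j, 1:])"
      using degree_prod_sum_le[of "{..<n}-{l}" "\<lambda>j. [:- x j, 1:]"] by (simp add: o_def)
    also have "\<dots> < n" using that by simp
    finally show ?thesis .
  qed
  have "map_poly to_ac p = (\<Sum>l<n. smult (ev p (x l)) (\<Lambda> l))"
  proof (rule poly_eqI_degree[of "x ` {..<n}"])
    fix y assume "y \<in> x ` {..<n}"
    then obtain m where m: "m < n" "y = x m" by auto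
    have "poly (\<Sum>l<n. smult (ev p (x l)) (\<Lambda> l)) y = (\<Sum>l<n. if l = m then ev p (x m) else 0)"
      unfolding poly_sum poly_smult using m by (intro sum.cong) (auto simp: eval)
    also have "\<dots> = ev p (x m)" using m by simp
    finally show "ev p y = poly (\<Sum>l<n. smult (ev p (x l)) (\<Lambda> l)) y" using m by simp
  next
    show "degree (map_poly to_ac p) < card (x ` {..<n})"
      using p inj_x by (simp add: card_image)
    show "degree (\<Sum>l<n. smult (ev p (x l)) (\<Lambda> l)) < card (x ` {..<n})"
      using n_pos inj_x deg
      by (auto simp: card_image intro!: degree_sum_less le_less_trans[OF degree_smult_le])
  qed
  from arg_cong[OF this, of "\<lambda>q. coeff q k"]
  have "coeff (map_poly to_ac p) k = (\<Sum>l<n. ev p (x l) * coeff (\<Lambda> l) k)"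
    by (simp add: coeff_sum)
  then show "to_ac (coeff p k) = (\<Sum>l<n. coeff (\<Lambda> l) k * ev p (x l))"
    by (simp add: mult.commute)
qed

lemma F_eq_span: "F = ac_vs.span ((\<lambda>k. x 0 ^ k) ` {..<n})"
proof
  show "F \<subseteq> ac_vs.span ((\<lambda>k. x 0 ^ k) ` {..<n})"
  proof
    fix y assume "y \<in> F"
    then obtain p where p: "y = ev p (x 0)" "degree p < n" by (rule F_E)
    have "y = (\<Sum>k\<le>degree p. to_ac (coeff p k) * x 0 ^ k)"
      using p by (simp add: poly_altdef)
    also have "\<dots> \<in> ac_vs.span ((\<lambda>k. x 0 ^ k) ` {..<n})"
      using p(2) by (intro ac_vs.span_sum ac_vs.span_scale ac_vs.span_base) auto
    finally show "y \<in> ac_vs.span ((\<lambda>k. x 0 ^ k) ` {..<n})" .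
  qed
  show "ac_vs.span ((\<lambda>k. x 0 ^ k) ` {..<n}) \<subseteq> F"
  proof (rule ac_vs.span_minimal)
    show "ac_vs.subspace F"
      unfolding ac_vs.subspace_def using to_ac_in_F[of 0] by (auto intro: F_add F_mult to_ac_in_F)
  qed (auto intro: F_power x0_in_F)
qed

lemma finite_basis:
  assumes "ac_vs.independent B" "ac_vs.span B = F"
  shows "finite B" "card B = n"
proof -
  let ?T = "(\<lambda>k. x 0 ^ k) ` {..<n}"
  have inj: "inj_on (\<lambda>k. x 0 ^ k) {..<n}"
  proof (rule inj_onI)
    fix i j assume ij: "i \<in> {..<n}" "j \<in> {..<n}" "x 0 ^ i = x 0 ^ j"
    \<comment> \<open>Two equal powers would give an annihilating polynomial of degree below
      \<open>n\<close>.\<close>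
    have "monom 1 i - monom 1 j = (0 :: 'k poly)"
      using ij by (intro minimal degree_diff_less) (auto simp: degree_monom_eq hom_distribs poly_monom)
    then show "i = j" by (metis monom_eq_iff' right_minus_eq zero_neq_one)
  qed
  have indep: "ac_vs.independent ?T"
  proof (rule ac_vs.independent_if_scalars_zero)
    fix f y assume f: "(\<Sum>y\<in>?T. to_ac (f y) * y) = 0" "y \<in> ?T"
    define p where "p = (\<Sum>k<n. monom (f (x 0 ^ k)) k)"
    have "ev p (x 0) = (\<Sum>k<n. to_ac (f (x 0 ^ k)) * x 0 ^ k)"
      unfolding p_def by (simp add: hom_distribs poly_sum poly_monom)
    also have "\<dots> = 0" using f(1) by (simp add: sum.reindex[OF inj])
    finally have "p = 0"
      using n_pos by (intro minimal) (auto simp: p_def degree_monom_eq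
          intro!: degree_sum_less le_less_trans[OF degree_monom_le])
    from f(2) obtain k where k: "k < n" "y = x 0 ^ k" by auto
    have "coeff p k = f y" using k by (simp add: p_def coeff_sum)
    then show "f y = 0" using \<open>p = 0\<close> by simp
  qed simp
  have B: "finite B \<and> card B \<le> card ?T"
    using assms F_eq_span ac_vs.span_superset[of B]
    by (intro ac_vs.independent_span_bound) auto
  moreover have "card ?T \<le> card B"
    using B assms F_eq_span ac_vs.span_superset[of ?T] ac_vs.independent_span_bound[of B ?T] indep
    by auto
  ultimately show "finite B" "card B = n" by (auto simp: card_image inj)
qed

text \<open>The basis inside \<open>field_trace\<close> is arbitrary. Its coordinate functions are
  combinations of the conjugates with coefficients \<open>U b l\<close>, and \<open>U\<close> is
  dual to the matrix of conjugates of the basis. Inserting this in the diagonal sum leaves one copy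
  of each conjugate of \<open>y\<close>.\<close>

lemma field_trace_eq:
  assumes "y \<in> F"
  shows "to_ac (field_trace F y) = (\<Sum>l<n. conj l y)"
proof -
  define B where "B = (SOME B. ac_vs.independent B \<and> ac_vs.span B = F)"
  have "\<exists>B. ac_vs.independent B \<and> ac_vs.span B = F"
    using ac_vs.basis_exists[of "F"] ac_vs.span_span
    by (metis F_eq_span ac_vs.span_subspace ac_vs.subspace_span)
  from someI_ex[OF this] have B: "ac_vs.independent B" "ac_vs.span B = F"
    unfolding B_def by auto
  have fin: "finite B" using finite_basis B by blast
  have B_F: "b \<in> F" if "b \<in> B" for b using that B(2) ac_vs.span_base by blast
  let ?rep = "ac_vs.representation B"
  have rep_sum: "(\<Sum>b\<in>B. to_ac (?rep z b) * b) = z" if "z \<in> F" for z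
  proof -
    have "(\<Sum>b\<in>B. to_ac (?rep z b) * b) = (\<Sum>b | ?rep z b \<noteq> 0. to_ac (?rep z b) * b)"
      using fin by (intro sum.mono_neutral_right) (auto dest: ac_vs.representation_ne_zero)
    then show ?thesis
      using ac_vs.sum_nonzero_representation_eq[OF B(1), of z] that B(2) by simp
  qed
  obtain W where W: "\<And>p k. degree p < n \<Longrightarrow> to_ac (coeff p k) = (\<Sum>l<n. W k l * ev p (x l))"
    using coeff_eq_sum_conjugates by blast
  define U where "U b l = (\<Sum>k<n. W k l * to_ac (?rep (x 0 ^ k) b))" for b l
  have rep: "to_ac (?rep z b) = (\<Sum>l<n. U b l * conj l z)" if "z \<in> F" for z b
  proof -
    obtain p where p: "z = ev p (x 0)" "degree p < n" using \<open>z \<in> F\<close> by (rule F_E)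
    have z: "z = (\<Sum>k<n. to_ac (coeff p k) * x 0 ^ k)"
      unfolding p(1) poly_altdef using p(2)
      by (intro sum.mono_neutral_cong_left) (auto simp: coeff_eq_0)
    have "?rep z b = (\<Sum>k<n. coeff p k * ?rep (x 0 ^ k) b)"
      unfolding z
      by (simp add: ac_vs.representation_sum ac_vs.representation_scale B F_mult to_ac_in_F
          F_power x0_in_F)
    then have "to_ac (?rep z b) = (\<Sum>k<n. \<Sum>l<n. W k l * to_ac (?rep (x 0 ^ k) b) * ev p (x l))"
      by (simp add: to_ac_sum W[OF p(2)] sum_distrib_left sum_distrib_right mult_ac)
    also have "\<dots> = (\<Sum>l<n. U b l * conj l z)"
      by (subst sum.swap) (simp add: U_def sum_distrib_right p(1) conj_ev)
    finally show ?thesis .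
  qed
  \<comment> \<open>Applying \<open>conj m\<close> to the expansion of each power of
    \<open>x 0\<close> shows that the coefficients \<open>c l\<close> annihilate all power sums,
    hence vanish. Only \<open>c m\<close> is needed.\<close>
  have diag: "(\<Sum>b\<in>B. U b m * conj m b) = 1" if "m < n" for m
  proof -
    define c where "c l = (\<Sum>b\<in>B. U b l * conj m b) - (if l = m then 1 else 0)" for l
    have "(\<Sum>l<n. c l * x l ^ k) = 0" for k
    proof -
      let ?z = "x 0 ^ k"
      have z: "?z \<in> F" by (intro F_power x0_in_F)
      have conj_z: "conj l ?z = x l ^ k" if "l < n" for l
        using that by (simp add: conj_power x0_in_F conj_x0)
      have "conj m ?z = conj m (\<Sum>b\<in>B. to_ac (?rep ?z b) * b)" by (simp add: rep_sum[OF z])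
      also have "\<dots> = (\<Sum>b\<in>B. to_ac (?rep ?z b) * conj m b)"
        using that by (simp add: conj_sum F_mult to_ac_in_F B_F conj_mult conj_to_ac)
      also have "\<dots> = (\<Sum>b\<in>B. \<Sum>l<n. U b l * conj m b * conj l ?z)"
        unfolding rep[OF z] by (simp add: sum_distrib_left sum_distrib_right mult_ac)
      also have "\<dots> = (\<Sum>l<n. (\<Sum>b\<in>B. U b l * conj m b) * x l ^ k)"
        by (subst sum.swap) (simp add: sum_distrib_right conj_z)
      finally have "x m ^ k = (\<Sum>l<n. (\<Sum>b\<in>B. U b l * conj m b) * x l ^ k)"
        using that by (simp add: conj_z)
      moreover have "(\<Sum>l<n. (if l = m then 1 else 0) * x l ^ k) = x m ^ k"
        using that by (simp add: if_distrib[of "\<lambda>a. a * _"] cong: if_cong)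
      ultimately show ?thesis by (simp add: c_def left_diff_distrib sum_subtractf)
    qed
    from power_sums_independent[OF this that] show ?thesis by (simp add: c_def)
  qed
  have "to_ac (field_trace F y) = (\<Sum>b\<in>B. to_ac (?rep (y * b) b))"
    by (simp add: field_trace_def B_def[symmetric] to_ac_sum Let_def)
  also have "\<dots> = (\<Sum>b\<in>B. \<Sum>l<n. conj l y * (U b l * conj l b))"
    using assms by (intro sum.cong refl) (subst rep, auto simp: F_mult B_F conj_mult mult_ac)
  also have "\<dots> = (\<Sum>l<n. conj l y * (\<Sum>b\<in>B. U b l * conj l b))"
    by (subst sum.swap) (simp add: sum_distrib_left)
  also have "\<dots> = (\<Sum>l<n. conj l y)" by (simp add: diag)
  finally show ?thesis .
qed

text \<open>Since traces are sums of conjugates, the matrix of the trace form is the matrix of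
  conjugates times its transpose.\<close>

lemma basis_discriminant_eq:
  assumes "length bs = n" "set bs \<subseteq> F"
  shows "to_ac (basis_discriminant F bs) = det (mat n n (\<lambda>(i, l). conj l (bs ! i))) ^ 2"
proof -
  define M where "M = mat n n (\<lambda>(i, l). conj l (bs ! i))"
  have bs: "bs ! i \<in> F" if "i < n" for i using assms that by auto
  have "to_ac (basis_discriminant F bs) = det (map_mat to_ac (mat n n (\<lambda>(i, j). field_trace F (bs ! i * bs ! j))))"
    by (simp add: basis_discriminant_def assms to_ac.hom_det)
  also have "map_mat to_ac (mat n n (\<lambda>(i, j). field_trace F (bs ! i * bs ! j))) = M * M\<^sup>T"
  proof (rule eq_matI)
    fix i j assume "i < dim_row (M * M\<^sup>T)" "j < dim_col (M * M\<^sup>T)"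
    then have ij: "i < n" "j < n" by (auto simp: M_def)
    then show "map_mat to_ac (mat n n (\<lambda>(i, j). field_trace F (bs ! i * bs ! j))) $$ (i, j) = (M * M\<^sup>T) $$ (i, j)"
      by (simp add: field_trace_eq F_mult bs M_def scalar_prod_def conj_mult atLeast0LessThan)
  qed (auto simp: M_def)
  also have "det (M * M\<^sup>T) = det M ^ 2"
    by (simp add: det_mult[of _ n] det_transpose[of _ n] M_def power2_eq_square)
  finally show ?thesis by (simp add: M_def)
qed

end

subsection \<open>Totally ramified extensions\<close>

lemma (in valued) v_det_ge:
  assumes "A \<in> carrier_mat n n" "\<And>i j. i < n \<Longrightarrow> j < n \<Longrightarrow> 0 \<le> v (A $$ (i, j))"
  shows "0 \<le> v (det A)"
proof -
  have "det A = (\<Sum>p | p permutes {0..<n}. signof p * (\<Prod>i = 0..<n. A $$ (i, p i)))"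
    using assms(1) by (simp add: det_def)
  also have "0 \<le> v \<dots>"
    using assms(2)
    by (intro v_sum_ge v_mult_ge v_prod_ge)
      (auto simp: sign_def dest: permutes_in_image[where S = "{0..<n}"])
  finally show ?thesis .
qed

text \<open>Grouping ordered pairs into unordered ones relates the product of all root differences
  to the square of the Vandermonde determinant.\<close>

lemma sum_off_diagonal:
  fixes f :: "nat \<Rightarrow> nat \<Rightarrow> 'a :: comm_monoid_add"
  shows "(\<Sum>i<n. \<Sum>j\<in>{..<n} - {i}. f i j) = (\<Sum>i<n. \<Sum>j<i. f i j + f j i)"
proof (induction n)
  case (Suc n)
  have "(\<Sum>j\<in>{..<Suc n} - {i}. f i j) = (\<Sum>j\<in>{..<n} - {i}. f i j) + f i n" if "i < n" for i
  proof -
    have "{..<Suc n} - {i} = insert n ({..<n} - {i})" using that by auto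
    then show ?thesis by (simp add: add.commute)
  qed
  moreover have "{..<Suc n} - {n} = {..<n}" by auto
  ultimately show ?case by (simp add: Suc sum.distrib add_ac)
qed simp

text \<open>Multiplication by \<open>m\<close> permutes the residues modulo \<open>n\<close>, so the
  remainders \<open>i * m mod n\<close> add up to 0 + 1 + ... + (n - 1), and division with remainder
  gives the sum of the quotients. These quotients are the exponents of \<pi> in the integral basis
  below.\<close>

lemma sum_mult_div:
  assumes "coprime m n" "n > 0"
  shows "2 * (\<Sum>i<n. real (i * m div n)) = (real m - 1) * (real n - 1)"
proof -
  have inj: "inj_on (\<lambda>i. i * m mod n) {..<n}"
  proof (rule inj_onI)
    fix i j assume ij: "i \<in> {..<n}" "j \<in> {..<n}" "i * m mod n = j * m mod n"
    then have "[i * m = j * m] (mod n)" by (simp add: cong_def)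
    then have "[i = j] (mod n)" using assms(1) cong_mult_rcancel_nat by blast
    then show "i = j" using ij by (simp add: cong_def)
  qed
  have "(\<lambda>i. i * m mod n) ` {..<n} \<subseteq> {..<n}"
    using assms(2) by (simp add: image_subset_iff)
  then have surj: "(\<lambda>i. i * m mod n) ` {..<n} = {..<n}"
    by (rule endo_inj_surj[OF finite_lessThan _ inj])
  have "(\<Sum>i<n. i * m mod n) = sum id ((\<lambda>i. i * m mod n) ` {..<n})"
    by (subst sum.reindex[OF inj]) (simp add: o_def)
  then have "(\<Sum>i<n. i * m mod n) = (\<Sum>i<n. i)" unfolding surj by simp
  then have modsum: "(\<Sum>i<n. real (i * m mod n)) = (\<Sum>i<n. real i)"
    unfolding of_nat_sum[symmetric] by (simp only:)
  have s: "2 * (\<Sum>i<n. real i) = real n * (real n - 1)"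
    by (induction n) (auto simp: algebra_simps)
  have "real n * (\<Sum>i<n. real (i * m div n)) = (\<Sum>i<n. real i * real m - real (i * m mod n))"
    unfolding sum_distrib_left
  proof (rule sum.cong)
    fix i
    have "real i * real m = real n * real (i * m div n) + real (i * m mod n)"
      by (metis mult_div_mod_eq of_nat_add of_nat_mult)
    then show "real n * real (i * m div n) = real i * real m - real (i * m mod n)" by linarith
  qed simp
  also have "\<dots> = (real m - 1) * (\<Sum>i<n. real i)"
    by (simp add: sum_subtractf modsum sum_distrib_right[symmetric] algebra_simps)
  finally have "real n * (2 * (\<Sum>i<n. real (i * m div n))) = (real m - 1) * (2 * (\<Sum>i<n. real i))"
    by (simp only: mult.left_commute[of _ "2::real"])
  then have "real n * (2 * (\<Sum>i<n. real (i * m div n))) = real n * ((real m - 1) * (real n - 1))"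
    unfolding s by (simp only: mult_ac)
  then show ?thesis using assms(2) by simp
qed

lemma integral_basis_mem:
  assumes "integral_basis v F bs" "i < length bs" "valuation v"
  shows "bs ! i \<in> F" "0 \<le> v (bs ! i)"
proof -
  interpret valued v by standard (rule assms)
  have "bs ! i = (\<Sum>j<length bs. to_ac (if j = i then 1 else 0) * bs ! j)"
    using assms(2) by (simp add: if_distrib[of to_ac] if_distrib[of "\<lambda>a. a * _"] cong: if_cong)
  then have "bs ! i \<in> {x \<in> F. 0 \<le> v x}"
    using assms(1) unfolding integral_basis_def
    by (auto intro!: exI[of _ "\<lambda>j. if j = i then 1 else 0"])
  then show "bs ! i \<in> F" "0 \<le> v (bs ! i)" by auto
qed

lemma integral_basis_change:
  assumes "integral_basis v F bs" "integral_basis v F bs'" "valuation v"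
  obtains C where "\<And>i. i < length bs \<Longrightarrow> bs ! i = (\<Sum>j<length bs'. to_ac (C i j) * bs' ! j)"
    "\<And>i j. i < length bs \<Longrightarrow> j < length bs' \<Longrightarrow> 0 \<le> v (to_ac (C i j))"
proof -
  have "\<exists>c. bs ! i = (\<Sum>j<length bs'. to_ac (c j) * bs' ! j) \<and> (\<forall>j<length bs'. 0 \<le> v (to_ac (c j)))"
    if "i < length bs" for i
    using integral_basis_mem[OF assms(1) that assms(3)] assms(2)
    unfolding integral_basis_def by blast
  then obtain C where "\<And>i. i < length bs \<Longrightarrow> bs ! i = (\<Sum>j<length bs'. to_ac (C i j) * bs' ! j) \<and> (\<forall>j<length bs'. 0 \<le> v (to_ac (C i j)))"
    by metis
  then show ?thesis using that by blast
qed

text \<open>The valuation of \<open>x 0\<close> has exact denominator \<open>n\<close>, so \<open>x 0\<close> generates a totally ramified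
  extension of degree \<open>n\<close>, and scaled powers of \<open>x 0\<close> form an integral basis.\<close>

locale totally_ramified = valued v
  for v :: "'k::field alg_closure \<Rightarrow> ereal" +
  fixes \<pi> :: 'k and n m :: nat and x :: "nat \<Rightarrow> 'k alg_closure" and P :: "'k poly"
  assumes v_to_ac_int: "\<And>c. c \<noteq> 0 \<Longrightarrow> \<exists>k::int. v (to_ac c) = ereal (of_int k)"
    and v_uniformizer: "v (to_ac \<pi>) = 1"
    and n_pos: "n > 0"
    and degree_P: "degree P = n"
    and roots: "\<And>i. i < n \<Longrightarrow> poly (map_poly to_ac P) (x i) = 0"
    and inj_x: "inj_on x {..<n}"
    and v_x0: "v (x 0) = ereal (real m / real n)"
    and coprime: "coprime m n"
begin

lemma uniformizer_neq_0: "\<pi> \<noteq> 0"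
  using v_uniformizer by auto

lemma x0_neq_0: "x 0 \<noteq> 0"
  using v_x0 by auto

lemma v_monomial:
  "v (to_ac c) = ereal a \<Longrightarrow> v (to_ac c * x 0 ^ k) = ereal (a + real k * real m / real n)"
  by (simp add: v_mult v_power v_x0)

text \<open>Valuations of base field elements are integers, so equality would make \<open>n\<close>
  divide (i - j) m, hence i - j, which is too small in absolute value.\<close>

lemma v_monomial_distinct:
  assumes "i < n" "j < n" "i \<noteq> j" "c \<noteq> 0"
  shows "v (to_ac c * x 0 ^ i) \<noteq> v (to_ac d * x 0 ^ j)"
proof
  assume eq: "v (to_ac c * x 0 ^ i) = v (to_ac d * x 0 ^ j)"
  obtain a where a: "v (to_ac c) = ereal (of_int a)" using v_to_ac_int assms by blast
  have "d \<noteq> 0" using eq v_monomial[OF a, of i] by auto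
  then obtain b where b: "v (to_ac d) = ereal (of_int b)" using v_to_ac_int by blast
  have "ereal (of_int a + real i * real m / real n) = ereal (of_int b + real j * real m / real n)"
    using eq by (simp only: v_monomial[OF a] v_monomial[OF b])
  then have "real n * (of_int a + real i * real m / real n) = real n * (of_int b + real j * real m / real n)"
    by (simp only: ereal.inject)
  moreover have "real n * (of_int c + real k * real m / real n) = of_int (c * int n + int k * int m)" for c k
    using n_pos by (simp add: distrib_left)
  ultimately have "real_of_int (a * int n + int i * int m) = of_int (b * int n + int j * int m)"
    by (simp only:)
  then have "a * int n + int i * int m = b * int n + int j * int m" by (simp only: of_int_eq_iff)
  then have "(int i - int j) * int m = int n * (b - a)" by (simp add: algebra_simps)
  then have "int n dvd (int i - int j) * int m" by simp
  then have "int n dvd int i - int j"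
    using coprime by (simp add: coprime_dvd_mult_left_iff coprime_commute)
  then have "\<bar>int i - int j\<bar> \<ge> int n"
    using assms(3) dvd_imp_le_int[of "int i - int j" "int n"] by simp
  then show False using assms by linarith
qed

lemma v_sum_monomials_le:
  assumes "k < n"
  shows "v (\<Sum>i<n. to_ac (c i) * x 0 ^ i) \<le> v (to_ac (c k) * x 0 ^ k)"
  using assms v_monomial_distinct by (intro v_sum_le_of_distinct) auto

text \<open>If a polynomial of degree below \<open>n\<close> vanishes at \<open>x 0\<close>, its
  value has valuation infinity; no monomial has smaller valuation than the sum, so every monomial,
  and hence every coefficient, is zero.\<close>

sublocale separable_element n x P
proof
  fix p :: "'k poly" assume p: "degree p < n" "poly (map_poly to_ac p) (x 0) = 0"
  have "(\<Sum>i<n. to_ac (coeff p i) * x 0 ^ i) = poly (map_poly to_ac p) (x 0)"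
    unfolding poly_altdef using p(1)
    by (intro sum.mono_neutral_cong_right) (auto simp: coeff_eq_0)
  then have "coeff p k = 0" if "k < n" for k
    using v_sum_monomials_le[OF that, of "coeff p"] x0_neq_0 p(2) by auto
  then show "p = 0" using p(1) by (metis leading_coeff_0_iff)
qed (use n_pos degree_P roots inj_x in auto)

text \<open>The power of \<pi> removes the integral part of the valuation of the power of
  \<open>x 0\<close>, so that \<open>e k\<close> has as valuation the fractional part of k m /
  n.\<close>

definition e :: "nat \<Rightarrow> 'k alg_closure" where
  "e k = to_ac (inverse \<pi> ^ (k * m div n)) * x 0 ^ k"

lemma e_in_F: "e k \<in> F"
  unfolding e_def by (intro F_mult to_ac_in_F F_power x0_in_F)

lemma e_neq_0: "e k \<noteq> 0"
  using uniformizer_neq_0 x0_neq_0 by (simp add: e_def)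

lemma v_e: "v (e k) = ereal (real (k * m mod n) / real n)"
proof -
  have "v (e k) = ereal (- real (k * m div n) + real k * real m / real n)"
    unfolding e_def
  proof (rule v_monomial)
    show "v (to_ac (inverse \<pi> ^ (k * m div n))) = ereal (- real (k * m div n))"
      using uniformizer_neq_0 v_uniformizer
      by (simp add: v_power v_inverse one_ereal_def)
  qed
  moreover have "real k * real m = real n * real (k * m div n) + real (k * m mod n)"
    by (metis mult_div_mod_eq of_nat_add of_nat_mult)
  then have "real k * real m / real n = real (k * m div n) + real (k * m mod n) / real n"
    using n_pos by (simp only: add_divide_distrib) simp
  ultimately show ?thesis by simp
qed

lemma v_sum_e_le:
  assumes "k < n"
  shows "v (\<Sum>i<n. to_ac (c i) * e i) \<le> v (to_ac (c k) * e k)"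
  using v_sum_monomials_le[OF assms, of "\<lambda>i. c i * inverse \<pi> ^ (i * m div n)"]
  by (simp add: e_def mult_ac)

lemma F_eq_sum_e:
  assumes "y \<in> F"
  obtains c where "y = (\<Sum>i<n. to_ac (c i) * e i)"
proof -
  obtain p where p: "y = poly (map_poly to_ac p) (x 0)" "degree p < n" using assms by (rule F_E)
  have "y = (\<Sum>i<n. to_ac (coeff p i) * x 0 ^ i)"
    unfolding p(1) poly_altdef using p(2)
    by (intro sum.mono_neutral_cong_left) (auto simp: coeff_eq_0)
  also have "\<dots> = (\<Sum>i<n. to_ac (coeff p i * \<pi> ^ (i * m div n)) * e i)"
    using uniformizer_neq_0 by (simp add: e_def field_simps power_inverse)
  finally show ?thesis by (rule that)
qed

text \<open>The valuation of \<open>c\<close> is an integer and that of \<open>e k\<close> is less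
  than 1, so a nonnegative total forces the integer to be greater than -1.\<close>

lemma v_to_ac_ge:
  assumes "k < n" "0 \<le> v (to_ac c * e k)"
  shows "0 \<le> v (to_ac c)"
proof (cases "c = 0")
  case False
  then obtain a :: int where a: "v (to_ac c) = ereal (of_int a)" using v_to_ac_int by blast
  have "0 \<le> of_int a + real (k * m mod n) / real n"
    using assms(2) by (simp add: v_mult a v_e)
  moreover have "real (k * m mod n) / real n < 1" using n_pos by simp
  ultimately have "of_int a > (-1 :: real)" by linarith
  then show ?thesis using a by simp
qed simp

lemma inj_e: "inj_on e {..<n}"
proof (rule inj_onI)
  fix i j assume ij: "i \<in> {..<n}" "j \<in> {..<n}" "e i = e j"
  show "i = j"
  proof (rule ccontr)
    assume "i \<noteq> j"
    then have "v (e i) \<noteq> v (e j)"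
      unfolding e_def using ij(1,2) uniformizer_neq_0
      by (intro v_monomial_distinct power_not_zero) auto
    then show False by (simp only: ij(3))
  qed
qed

lemma integral_basis_e: "integral_basis v F (map e [0..<n])"
  unfolding integral_basis_def
proof (intro conjI)
  show "distinct (map e [0..<n])"
    using inj_e by (simp add: distinct_map atLeast0LessThan)
  show "ac_vs.independent (set (map e [0..<n]))"
  proof (rule ac_vs.independent_if_scalars_zero)
    fix f y assume f: "(\<Sum>y\<in>set (map e [0..<n]). to_ac (f y) * y) = 0" "y \<in> set (map e [0..<n])"
    then obtain k where k: "k < n" "y = e k" by auto
    have "(\<Sum>i<n. to_ac (f (e i)) * e i) = 0"
      using f(1) by (simp add: atLeast0LessThan sum.reindex[OF inj_e])
    then show "f y = 0" using v_sum_e_le[OF k(1), of "\<lambda>i. f (e i)"] k(2) e_neq_0 by auto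
  qed simp
  \<comment> \<open>Integrality can be tested term by term, because the valuation of the sum does
    not exceed that of any of its terms.\<close>
  have "(0 \<le> v (\<Sum>i<n. to_ac (c i) * e i)) \<longleftrightarrow> (\<forall>i<n. 0 \<le> v (to_ac (c i)))" for c
  proof
    show "\<forall>i<n. 0 \<le> v (to_ac (c i))" if "0 \<le> v (\<Sum>i<n. to_ac (c i) * e i)"
      using v_sum_e_le[of _ c] v_to_ac_ge that by (meson order_trans)
    show "0 \<le> v (\<Sum>i<n. to_ac (c i) * e i)" if "\<forall>i<n. 0 \<le> v (to_ac (c i))"
      using that by (intro v_sum_ge v_mult_ge) (auto simp: v_e)
  qed
  then show "{y \<in> F. 0 \<le> v y} =
      {\<Sum>i<length (map e [0..<n]). to_ac (c i) * map e [0..<n] ! i | c.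
        \<forall>i<length (map e [0..<n]). 0 \<le> v (to_ac (c i))}"
    by (auto elim!: F_eq_sum_e intro!: F_sum F_mult to_ac_in_F e_in_F)
qed

definition M :: "'k alg_closure list \<Rightarrow> 'k alg_closure mat" where
  "M bs = mat n n (\<lambda>(i, l). conj l (bs ! i))"

text \<open>Every \<open>e i\<close> is integral, hence a combination of the given basis, so that
  basis spans \<open>F\<close> over the base field.\<close>

lemma length_integral_basis:
  assumes "integral_basis v F bs"
  shows "length bs = n"
proof -
  have bs: "distinct bs" "ac_vs.independent (set bs)" using assms by (auto simp: integral_basis_def)
  have "ac_vs.span (set bs) = F"
  proof
    show "ac_vs.span (set bs) \<subseteq> F"
      using integral_basis_mem[OF assms _ valuation] unfolding F_eq_span
      by (intro ac_vs.span_minimal ac_vs.subspace_span) (auto simp: in_set_conv_nth)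
    show "F \<subseteq> ac_vs.span (set bs)"
    proof
      fix y assume "y \<in> F"
      then obtain c where y: "y = (\<Sum>i<n. to_ac (c i) * e i)" by (rule F_eq_sum_e)
      have "e i \<in> ac_vs.span (set bs)" for i
      proof -
        have "e i \<in> {y \<in> F. 0 \<le> v y}" using e_in_F by (auto simp: v_e)
        then obtain c where "e i = (\<Sum>j<length bs. to_ac (c j) * bs ! j)"
          using assms unfolding integral_basis_def by blast
        then show ?thesis
          by (simp only:) (intro ac_vs.span_sum ac_vs.span_scale ac_vs.span_base, simp)
      qed
      then show "y \<in> ac_vs.span (set bs)"
        unfolding y by (intro ac_vs.span_sum ac_vs.span_scale)
    qed
  qed
  then show ?thesis using finite_basis(2)[OF bs(2)] distinct_card[OF bs(1)] by simp
qed

text \<open>The change of basis has integral entries in the base field, which the conjugations fix,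
  so it multiplies the matrix of conjugates. Used in both directions, this makes the valuation of
  the discriminant independent of the basis picked in its definition.\<close>

lemma v_det_M_le:
  assumes bs: "integral_basis v F bs" and bs': "integral_basis v F bs'"
  shows "v (det (M bs')) \<le> v (det (M bs))"
proof -
  note len = length_integral_basis[OF bs] length_integral_basis[OF bs']
  obtain C where C: "\<And>i. i < n \<Longrightarrow> bs ! i = (\<Sum>j<n. to_ac (C i j) * bs' ! j)"
    "\<And>i j. i < n \<Longrightarrow> j < n \<Longrightarrow> 0 \<le> v (to_ac (C i j))"
    using integral_basis_change[OF bs bs' valuation] unfolding len by blast
  define A where "A = mat n n (\<lambda>(i, j). to_ac (C i j))"
  have "M bs = A * M bs'"
  proof (rule eq_matI)
    fix i l assume "i < dim_row (A * M bs')" "l < dim_col (A * M bs')"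
    then have il: "i < n" "l < n" by (auto simp: A_def M_def)
    have "conj l (bs ! i) = (\<Sum>j<n. to_ac (C i j) * conj l (bs' ! j))"
    proof -
      have mem: "bs' ! j \<in> F" if "j < n" for j
        using that len integral_basis_mem(1)[OF bs' _ valuation] by simp
      have "conj l (bs ! i) = (\<Sum>j<n. conj l (to_ac (C i j) * bs' ! j))"
        unfolding C(1)[OF il(1)] using il by (intro conj_sum) (auto intro: F_mult to_ac_in_F mem)
      also have "\<dots> = (\<Sum>j<n. to_ac (C i j) * conj l (bs' ! j))"
        using il by (intro sum.cong) (auto simp: conj_mult to_ac_in_F mem conj_to_ac)
      finally show ?thesis .
    qed
    then show "M bs $$ (i, l) = (A * M bs') $$ (i, l)"
      using il by (simp add: M_def A_def scalar_prod_def atLeast0LessThan)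
  qed (auto simp: M_def A_def)
  then have "det (M bs) = det A * det (M bs')"
    by (simp add: det_mult[of _ n] A_def M_def)
  moreover have "0 \<le> v (det A)"
    by (rule v_det_ge[of _ n]) (auto simp: A_def C)
  ultimately show ?thesis
    by (simp add: v_mult ereal_le_add_self2 add_increasing)
qed

text \<open>The matrix of conjugates is a diagonal matrix of scaling factors times a transposed
  Vandermonde matrix.\<close>

lemma det_M_e:
  "det (M (map e [0..<n])) =
    (\<Prod>i<n. to_ac (inverse \<pi> ^ (i * m div n))) * (\<Prod>i<n. \<Prod>j<i. x i - x j)"
proof -
  define D where "D = mat n n (\<lambda>(i, j). if i = j then to_ac (inverse \<pi> ^ (i * m div n)) else 0)"
  define V where "V = mat n n (\<lambda>(i, j). x i ^ j)"
  have "M (map e [0..<n]) = D * V\<^sup>T"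
  proof (rule eq_matI)
    fix i l assume "i < dim_row (D * V\<^sup>T)" "l < dim_col (D * V\<^sup>T)"
    then have il: "i < n" "l < n" by (auto simp: D_def V_def)
    have "conj l (e i) = to_ac (inverse \<pi> ^ (i * m div n)) * x l ^ i"
      using il unfolding e_def
      by (simp only: conj_mult conj_to_ac conj_power conj_x0 to_ac_in_F F_power x0_in_F)
    then show "M (map e [0..<n]) $$ (i, l) = (D * V\<^sup>T) $$ (i, l)"
      using il by (simp add: M_def D_def V_def scalar_prod_def if_distrib[of "\<lambda>a. a * _"] cong: if_cong)
  qed (auto simp: M_def D_def V_def)
  then have "det (M (map e [0..<n])) = det D * det V"
    by (simp add: det_mult[of _ n] det_transpose[of _ n] D_def V_def)
  also have "det D = prod_list (diag_mat D)"
    by (rule det_upper_triangular[of _ n]) (auto simp: D_def upper_triangular_def)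
  also have "diag_mat D = map (\<lambda>i. to_ac (inverse \<pi> ^ (i * m div n))) [0..<n]"
    by (auto simp: D_def diag_mat_def)
  also have "prod_list \<dots> = (\<Prod>i<n. to_ac (inverse \<pi> ^ (i * m div n)))"
    by (simp add: prod.distinct_set_conv_list[symmetric] atLeast0LessThan)
  also have "det V = (\<Prod>i<n. \<Prod>j<i. x i - x j)"
    unfolding V_def by (rule det_vandermonde)
  finally show ?thesis .
qed

lemma v_discriminant:
  "v (to_ac (discriminant v F)) =
    v (\<Prod>i<n. \<Prod>j\<in>{..<n} - {i}. x i - x j) - ereal ((real m - 1) * (real n - 1))"
proof -
  define bs where "bs = (SOME bs. integral_basis v F bs)"
  have bs: "integral_basis v F bs"
    unfolding bs_def using integral_basis_e by (rule someI)
  have "to_ac (discriminant v F) = det (M bs) ^ 2"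
    unfolding discriminant_def bs_def[symmetric] M_def
    using length_integral_basis[OF bs] integral_basis_mem(1)[OF bs _ valuation]
    by (intro basis_discriminant_eq) (auto simp: in_set_conv_nth)
  moreover have "v (det (M bs)) = v (det (M (map e [0..<n])))"
    using v_det_M_le[OF bs integral_basis_e] v_det_M_le[OF integral_basis_e bs] by simp
  ultimately have "v (to_ac (discriminant v F)) = 2 * v (det (M (map e [0..<n])))"
    by (simp add: v_power)
  also have "v (det (M (map e [0..<n]))) =
      v (\<Prod>i<n. to_ac (inverse \<pi> ^ (i * m div n))) + v (\<Prod>i<n. \<Prod>j<i. x i - x j)"
    by (simp only: det_M_e v_mult)
  also have "v (\<Prod>i<n. to_ac (inverse \<pi> ^ (i * m div n))) = ereal (- (\<Sum>i<n. real (i * m div n)))"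
    using uniformizer_neq_0 v_uniformizer
    by (simp add: v_prod v_power v_inverse one_ereal_def sum_ereal sum_negf)
  finally have 1: "v (to_ac (discriminant v F)) =
      2 * (ereal (- (\<Sum>i<n. real (i * m div n))) + v (\<Prod>i<n. \<Prod>j<i. x i - x j))" .
  \<comment> \<open>Each unordered pair occurs twice, and the valuation ignores the sign of a
    difference.\<close>
  have "v (\<Prod>i<n. \<Prod>j\<in>{..<n} - {i}. x i - x j) = v (\<Prod>i<n. \<Prod>j<i. x i - x j) + v (\<Prod>i<n. \<Prod>j<i. x i - x j)"
    unfolding v_prod sum_off_diagonal
    by (subst v_diff_commute[of "x j" "x i" for i j]) (simp add: sum.distrib)
  moreover have "x i \<noteq> x j" if "i < n" "j < i" for i j
    using inj_onD[OF inj_x, of i j] that by auto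
  \<comment> \<open>A nonzero product has a real valuation, so the extended real equation can be
    rearranged freely.\<close>
  then have "(\<Prod>i<n. \<Prod>j<i. x i - x j) \<noteq> 0" by simp
  then obtain a where "v (\<Prod>i<n. \<Prod>j<i. x i - x j) = ereal a" using v_real by blast
  ultimately show ?thesis
    using 1 sum_mult_div[OF coprime n_pos] by (simp add: algebra_simps)
qed

end

subsection \<open>Dickson polynomials\<close>

fun dickson :: "'a::comm_ring_1 \<Rightarrow> nat \<Rightarrow> 'a poly" where
  "dickson a 0 = [:2:]"
| "dickson a (Suc 0) = [:0, 1:]"
| "dickson a (Suc (Suc n)) = [:0, 1:] * dickson a (Suc n) - smult a (dickson a n)"

fun dickson2 :: "'a::comm_ring_1 \<Rightarrow> nat \<Rightarrow> 'a poly" where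
  "dickson2 a 0 = 1"
| "dickson2 a (Suc 0) = [:0, 1:]"
| "dickson2 a (Suc (Suc n)) = [:0, 1:] * dickson2 a (Suc n) - smult a (dickson2 a n)"

lemma poly_dickson: "poly (dickson (t * s) n) (t + s) = t ^ n + s ^ n"
proof -
  have "poly (dickson (t * s) n) (t + s) = t ^ n + s ^ n \<and>
      poly (dickson (t * s) (Suc n)) (t + s) = t ^ Suc n + s ^ Suc n"
    by (induction n) (auto simp: algebra_simps)
  then show ?thesis ..
qed

lemma poly_dickson2: "(t - s) * poly (dickson2 (t * s) n) (t + s) = t ^ Suc n - s ^ Suc n"
proof -
  have "(t - s) * poly (dickson2 (t * s) n) (t + s) = t ^ Suc n - s ^ Suc n \<and>
      (t - s) * poly (dickson2 (t * s) (Suc n)) (t + s) = t ^ Suc (Suc n) - s ^ Suc (Suc n)"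
  proof (induction n)
    case (Suc n)
    have "(t - s) * poly (dickson2 (t * s) (Suc (Suc n))) (t + s) =
        (t + s) * ((t - s) * poly (dickson2 (t * s) (Suc n)) (t + s)) -
        t * s * ((t - s) * poly (dickson2 (t * s) n) (t + s))"
      by (simp add: algebra_simps)
    also have "\<dots> = t ^ Suc (Suc (Suc n)) - s ^ Suc (Suc (Suc n))"
      using Suc by (simp only:) (simp add: algebra_simps)
    finally show ?case using Suc by simp
  qed (simp add: algebra_simps)
  then show ?thesis ..
qed

text \<open>Both sides obey the same two-step recursion, so comparing two consecutive indices
  suffices. The identity removes the first kind from the derivative in
  \<open>pderiv_dickson\<close>.\<close>

lemma dickson_eq_dickson2:
  "dickson a (Suc (Suc n)) = dickson2 a (Suc (Suc n)) - smult a (dickson2 a n)"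
proof -
  have "dickson a (Suc (Suc n)) = dickson2 a (Suc (Suc n)) - smult a (dickson2 a n) \<and>
    dickson a (Suc (Suc (Suc n))) = dickson2 a (Suc (Suc (Suc n))) - smult a (dickson2 a (Suc n))"
  proof (induction n)
    case 0
    have "[:2 * a:] = [:a:] + [:a:]" by simp
    then show ?case by (simp add: algebra_simps)
  next
    case (Suc n)
    have rearrange: "x * (p1 - smult a p2) - smult a (p3 - smult a p4) =
        (x * p1 - smult a p3) - smult a (x * p2 - smult a p4)" for x p1 p2 p3 p4
      by (simp add: algebra_simps smult_diff_right)
    have "dickson a (Suc (Suc (Suc (Suc n)))) =
        [:0, 1:] * dickson a (Suc (Suc (Suc n))) - smult a (dickson a (Suc (Suc n)))"
      by (rule dickson.simps)
    also have "\<dots> = ([:0, 1:] * dickson2 a (Suc (Suc (Suc n))) - smult a (dickson2 a (Suc (Suc n)))) -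
        smult a ([:0, 1:] * dickson2 a (Suc n) - smult a (dickson2 a n))"
      using Suc by (simp only: rearrange)
    also have "\<dots> = dickson2 a (Suc (Suc (Suc (Suc n)))) - smult a (dickson2 a (Suc (Suc n)))"
      by (simp only: dickson2.simps(3))
    finally show ?case using Suc by blast
  qed
  then show ?thesis ..
qed

text \<open>Differentiating the recursion leaves one underived Dickson polynomial, which
  \<open>dickson_eq_dickson2\<close> rewrites; the recursion of the second kind then collects all
  terms into one multiple.\<close>

lemma pderiv_dickson:
  fixes a :: "'a :: idom"
  shows "pderiv (dickson a (Suc n)) = smult (of_nat (Suc n)) (dickson2 a n)"
proof -
  have "pderiv (dickson a (Suc n)) = smult (of_nat (Suc n)) (dickson2 a n) \<and>
    pderiv (dickson a (Suc (Suc n))) = smult (of_nat (Suc (Suc n))) (dickson2 a (Suc n))"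
  proof (induction n)
    case 0
    show ?case by (simp add: pderiv_mult pderiv_diff pderiv_smult pderiv_pCons)
  next
    case (Suc n)
    let ?X = "[:0, 1:] :: 'a poly"
    have *: "?X * dickson2 a (Suc n) = dickson2 a (Suc (Suc n)) + smult a (dickson2 a n)"
      by simp
    have "pderiv (dickson a (Suc (Suc (Suc n)))) =
        dickson a (Suc (Suc n)) + ?X * pderiv (dickson a (Suc (Suc n))) - smult a (pderiv (dickson a (Suc n)))"
      by (simp add: pderiv_mult pderiv_diff pderiv_smult pderiv_pCons del: dickson.simps(3)
          add: dickson.simps(3)[of a "Suc n"])
    also have "\<dots> = dickson2 a (Suc (Suc n)) - smult a (dickson2 a n) +
        smult (of_nat (Suc (Suc n))) (?X * dickson2 a (Suc n)) - smult (of_nat (Suc n)) (smult a (dickson2 a n))"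
      using Suc by (simp only: dickson_eq_dickson2) (simp add: mult_ac)
    also have "\<dots> = smult (of_nat (Suc (Suc (Suc n)))) (dickson2 a (Suc (Suc n)))"
      unfolding * by (rule poly_eqI) (simp add: algebra_simps del: dickson2.simps)
    finally show ?case using Suc by simp
  qed
  then show ?thesis ..
qed

lemma map_poly_dickson: "map_poly of_int (dickson u n) = dickson (of_int u) n"
  by (induction u n rule: dickson.induct) (simp_all add: of_int_poly_hom.hom_minus hom_distribs)

lemma map_poly_dickson2: "map_poly of_int (dickson2 u n) = dickson2 (of_int u) n"
  by (induction u n rule: dickson2.induct) (simp_all add: of_int_poly_hom.hom_minus hom_distribs)

lemma degree_dickson: "degree (dickson a n) \<le> n"
proof (induction a n rule: dickson.induct)
  case (3 a n)
  then show ?case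
    by (auto intro!: degree_diff_le order.trans[OF degree_pCons_le] order.trans[OF degree_smult_le])
qed auto

lemma coeff_dickson: "n > 0 \<Longrightarrow> coeff (dickson a n) n = 1"
proof (induction a n rule: dickson.induct)
  case (3 a n)
  have "coeff (dickson a n) (Suc (Suc n)) = 0"
    using degree_dickson[of a n] by (intro coeff_eq_0) simp
  then show ?case using 3 by simp
qed auto

lemma poly_dickson_0: "odd n \<Longrightarrow> poly (dickson a n) 0 = 0"
  by (induction a n rule: dickson.induct) auto

text \<open>Over the complex numbers write x = t + s and u = t s. The claim becomes the difference
  between the squares of a sum and a difference of powers, the latter being t - s times the second
  kind.\<close>

lemma dickson_pell:
  fixes u x :: int
  shows "poly (dickson u (Suc n)) x ^ 2 - 4 * u ^ Suc n = (x\<^sup>2 - 4 * u) * poly (dickson2 u n) x ^ 2"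
proof -
  define y where "y = csqrt (of_int (x\<^sup>2 - 4 * u))"
  define t where "t = (of_int x + y) / 2"
  define s where "s = (of_int x - y) / 2"
  have y: "y ^ 2 = of_int (x\<^sup>2 - 4 * u)" by (simp add: y_def)
  have ts: "t + s = of_int x" "t * s = of_int u" "t - s = y"
    using y by (simp_all add: t_def s_def field_simps power2_eq_square)
  have D: "of_int (poly (dickson u (Suc n)) x) = t ^ Suc n + s ^ Suc n"
    using poly_dickson[of t s "Suc n"] unfolding ts
    by (metis map_poly_dickson of_int_hom.poly_map_poly)
  have E: "y * of_int (poly (dickson2 u n) x) = t ^ Suc n - s ^ Suc n"
    using poly_dickson2[of t s n] unfolding ts
    by (metis map_poly_dickson2 of_int_hom.poly_map_poly)
  have "of_int (poly (dickson u (Suc n)) x ^ 2 - 4 * u ^ Suc n) = (t ^ Suc n + s ^ Suc n) ^ 2 - 4 * (t * s) ^ Suc n"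
    by (simp only: of_int_diff of_int_power of_int_mult D ts of_int_numeral)
  also have "\<dots> = (t ^ Suc n - s ^ Suc n) ^ 2"
    unfolding power_mult_distrib by (simp add: power2_eq_square algebra_simps del: power_Suc)
  also have "\<dots> = of_int ((x\<^sup>2 - 4 * u) * poly (dickson2 u n) x ^ 2)"
    unfolding E[symmetric] by (simp add: power_mult_distrib y)
  finally show ?thesis by (simp only: of_int_eq_iff)
qed

section \<open>Congruences modulo a prime\<close>

text \<open>Comparing coefficients in the derivative, \<open>p\<close> divides k times the
  coefficient of index k, hence the coefficient itself when 0 < k < p. The linear coefficient is
  \<open>p\<close> times E(0), which gives the value of \<open>T\<close> at 0.\<close>

lemma poly_deriv_divisible:
  fixes f E :: "int poly"
  assumes p: "prime p" and deg: "degree f \<le> p" "coeff f p = 1" and E: "pderiv f = smult (int p) E"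
  obtains T where "f = monom 1 p + smult (int p) ([:0, 1:] * T) + [:poly f 0:]" "poly T 0 = poly E 0"
proof
  define T where "T = (\<Sum>k<p - 1. monom (coeff f (Suc k) div int p) k)"
  have p1: "p > 1" using p prime_gt_1_nat by blast
  have coeff_T: "coeff T k = (if k < p - 1 then coeff f (Suc k) div int p else 0)" for k
    by (simp add: T_def coeff_sum)
  have deriv: "int (Suc k) * coeff f (Suc k) = int p * coeff E k" for k
    using arg_cong[OF E, of "\<lambda>q. coeff q k"] by (simp add: coeff_pderiv)
  have dvd: "int p dvd coeff f (Suc k)" if "k < p - 1" for k
  proof -
    have "int p dvd int (Suc k) * coeff f (Suc k)" using deriv[of k] by simp
    moreover have "\<not> int p dvd int (Suc k)"
      using that by (auto dest!: dvd_imp_le simp del: of_nat_Suc)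
    ultimately show ?thesis using p by (simp add: prime_dvd_mult_iff del: of_nat_Suc)
  qed
  show "f = monom 1 p + smult (int p) ([:0, 1:] * T) + [:poly f 0:]"
  proof (rule poly_eqI)
    fix k
    show "coeff f k = coeff (monom 1 p + smult (int p) ([:0, 1:] * T) + [:poly f 0:]) k"
    proof (cases k)
      case 0
      then show ?thesis using p1 by (simp add: poly_0_coeff_0)
    next
      case (Suc k')
      consider "k < p" | "k = p" | "k > p" by linarith
      then show ?thesis
      proof cases
        case 1
        then show ?thesis using Suc dvd[of k'] by (simp add: coeff_T)
      next
        case 2
        then show ?thesis using Suc deg(2) by (auto simp: coeff_T)
      next
        case 3
        then show ?thesis using Suc deg(1) by (simp add: coeff_T coeff_eq_0)
      qed
    qed
  qed
  have "coeff f (Suc 0) = int p * coeff E 0" using deriv[of 0] by simp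
  then show "poly T 0 = poly E 0"
    using p1 by (simp add: poly_0_coeff_0 coeff_T)
qed

lemma fermat_int:
  assumes "prime p"
  shows "int p dvd a ^ p - a"
proof -
  define b where "b = nat (a mod int p)"
  have p: "p > 1" using assms prime_gt_1_nat by blast
  have ab: "[a = int b] (mod int p)" using p by (simp add: b_def cong_def)
  have "[b ^ p = b] (mod p)"
  proof (cases "p dvd b")
    case True
    then have "p dvd b ^ p" using p by (auto intro: dvd_trans[OF _ dvd_power])
    then show ?thesis using True by (simp add: cong_def dvd_imp_mod_0)
  next
    case False
    then have "[b ^ (p - 1) * b = 1 * b] (mod p)"
      using fermat_theorem[OF assms] by (intro cong_mult) auto
    moreover have "b ^ (p - 1) * b = b ^ p" using p by (simp flip: power_Suc2)
    ultimately show ?thesis by simp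
  qed
  then have "[int b ^ p = int b] (mod int p)" by (metis cong_int_iff of_nat_power)
  then have "[a ^ p = a] (mod int p)"
    using ab by (meson cong_pow cong_sym cong_trans)
  then show ?thesis by (simp add: cong_iff_dvd_diff)
qed

text \<open>The derivative is divisible by \<open>p\<close> and the constant term is 0 for odd
  index, so the polynomial is congruent to the \<open>p\<close>-th power of X; Fermat's little
  theorem finishes.\<close>

lemma dickson_prime_cong:
  assumes "prime p" "odd p"
  shows "int p dvd poly (dickson u p) x - x"
proof -
  obtain q where q: "p = Suc q" using assms by (cases p) auto
  have "pderiv (dickson u p) = smult (int p) (dickson2 u q)"
    unfolding q by (rule pderiv_dickson)
  then obtain T where "dickson u p = monom 1 p + smult (int p) ([:0, 1:] * T) + [:poly (dickson u p) 0:]"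
    using poly_deriv_divisible[OF assms(1) degree_dickson coeff_dickson] q by blast
  from arg_cong[OF this, of "\<lambda>f. poly f x"]
  have "poly (dickson u p) x = x ^ p + int p * (x * poly T x)"
    by (simp add: poly_monom poly_dickson_0 assms(2))
  then have "poly (dickson u p) x - x = (x ^ p - x) + int p * (x * poly T x)" by simp
  then show ?thesis
    by (simp only:) (intro dvd_add fermat_int[OF assms(1)] dvd_triv_left)
qed

text \<open>Otherwise \<open>dickson_pell\<close> at \<open>- c\<close> makes \<open>p\<close>
  divide the square of the value of the first kind minus \<open>4 * u ^ p\<close>, while that value
  is congruent to \<open>- c\<close>.\<close>

lemma dickson2_prime_unit:
  assumes "prime p" "odd p" "\<not> int p dvd c\<^sup>2 - 4 * u ^ p"
  shows "\<not> int p dvd poly (dickson2 u (p - 1)) (- c)"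
proof
  assume "int p dvd poly (dickson2 u (p - 1)) (- c)"
  then have "int p dvd ((- c)\<^sup>2 - 4 * u) * poly (dickson2 u (p - 1)) (- c) ^ 2"
    by (simp add: power2_eq_square)
  moreover have "Suc (p - 1) = p" using assms by (cases p) auto
  ultimately have 1: "int p dvd poly (dickson u p) (- c) ^ 2 - 4 * u ^ p"
    using dickson_pell[of u "p - 1" "- c"] by simp
  have "int p dvd (poly (dickson u p) (- c) - (- c)) * (poly (dickson u p) (- c) + (- c))"
    using dickson_prime_cong[OF assms(1,2)] by (rule dvd_mult2)
  then have "int p dvd poly (dickson u p) (- c) ^ 2 - c\<^sup>2"
    by (simp add: power2_eq_square algebra_simps)
  from dvd_diff[OF 1 this] show False using assms(3) by simp
qed

section \<open>Roots of unity and differences of conjugates\<close>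

text \<open>If two powers agree, then \<eta> to the power j - i is 1; since j - i is invertible
  modulo the prime \<open>r\<close>, a further power recovers \<eta> itself and gives \<eta> =
  1.\<close>

lemma roots_of_unity_inj:
  fixes \<eta> :: "'a :: field"
  assumes "prime r" "\<eta> ^ r = 1" "\<eta> \<noteq> 1"
  shows "inj_on (\<lambda>i. \<eta> ^ i) {..<r}"
proof -
  have "\<eta> \<noteq> 0" using assms prime_gt_0_nat by (auto simp: power_0_left split: if_splits)
  have "False" if "i < j" "j < r" "\<eta> ^ i = \<eta> ^ j" for i j
  proof -
    have "\<eta> ^ i * \<eta> ^ (j - i) = \<eta> ^ j" using that(1) by (simp flip: power_add)
    then have "\<eta> ^ i * \<eta> ^ (j - i) = \<eta> ^ i * 1" using that(3) by simp
    then have *: "\<eta> ^ (j - i) = 1" using \<open>\<eta> \<noteq> 0\<close> by simp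
    have "\<not> r dvd j - i" using that by (auto dest: dvd_imp_le)
    then have "coprime (j - i) r" using assms(1) by (simp add: prime_imp_coprime coprime_commute)
    then obtain k where "[(j - i) * k = Suc 0] (mod r)" using cong_solve_coprime_nat by blast
    then have "(j - i) * k mod r = 1" using prime_gt_1_nat[OF assms(1)] by (simp add: cong_def)
    then have "(j - i) * k = r * ((j - i) * k div r) + 1" by (metis mult_div_mod_eq)
    then have "\<eta> ^ ((j - i) * k) = \<eta> ^ (r * ((j - i) * k div r) + 1)" by (rule arg_cong)
    then have "(\<eta> ^ (j - i)) ^ k = (\<eta> ^ r) ^ ((j - i) * k div r) * \<eta>"
      by (simp only: power_mult power_add power_one_right)
    then show False using * assms by simp
  qed
  then show ?thesis by (metis inj_onI lessThan_iff nat_neq_iff)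
qed

lemma prod_minus_roots_of_unity:
  fixes \<eta> :: "'a :: field"
  assumes "inj_on (\<lambda>i. \<eta> ^ i) {..<r}" "\<eta> ^ r = 1" "r > 0"
  shows "(\<Prod>i<r. y - \<eta> ^ i) = y ^ r - 1"
proof -
  have "(\<Prod>i<r. [:- (\<eta> ^ i), 1:]) = monom 1 r - 1"
  proof (rule poly_eqI_degree_lead_coeff[of _ r _ "(\<lambda>i. \<eta> ^ i) ` {..<r}"])
    show "coeff (\<Prod>i<r. [:- (\<eta> ^ i), 1:]) r = coeff (monom 1 r - 1) r"
      using assms(3) coeff_newton_poly(2)[of "\<lambda>i. \<eta> ^ i"] by simp
    show "r \<le> card ((\<lambda>i. \<eta> ^ i) ` {..<r})" using assms(1) by (simp add: card_image)
    show "degree (\<Prod>i<r. [:- (\<eta> ^ i), 1:]) \<le> r" by (rule coeff_newton_poly)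
    show "degree (monom 1 r - 1 :: 'a poly) \<le> r"
      by (intro degree_diff_le degree_monom_le) simp
    fix z assume "z \<in> (\<lambda>i. \<eta> ^ i) ` {..<r}"
    then obtain i where i: "i < r" "z = \<eta> ^ i" by auto
    have "z ^ r = 1" using i assms(2) by (metis power_commutes power_mult mult.commute power_one)
    moreover have "poly (\<Prod>i<r. [:- (\<eta> ^ i), 1:]) z = 0"
      using i by (auto simp: poly_prod)
    ultimately show "poly (\<Prod>i<r. [:- (\<eta> ^ i), 1:]) z = poly (monom 1 r - 1) z"
      by (simp add: poly_monom)
  qed
  from arg_cong[OF this, of "\<lambda>q. poly q y"] show ?thesis by (simp add: poly_prod poly_monom)
qed

text \<open>The monic \<open>q\<close> is the product of its linear factors, and at a root all but
  one summand of the derivative of the product vanish.\<close>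

lemma prod_root_differences:
  fixes x :: "nat \<Rightarrow> 'a :: idom"
  assumes "inj_on x {..<n}" "\<And>i. i < n \<Longrightarrow> poly q (x i) = 0" "degree q \<le> n" "coeff q n = 1" "i < n"
  shows "(\<Prod>j\<in>{..<n} - {i}. x i - x j) = poly (pderiv q) (x i)"
proof -
  have "q = (\<Prod>j<n. [:- x j, 1:])"
  proof (rule poly_eqI_degree_lead_coeff[of _ n _ "x ` {..<n}"])
    show "n \<le> card (x ` {..<n})" using assms(1) by (simp add: card_image)
  qed (use assms coeff_newton_poly[of x n] in \<open>auto simp: poly_prod\<close>)
  then have "poly (pderiv q) (x i) =
      (\<Sum>k<n. (\<Prod>j\<in>{..<n} - {k}. x i - x j))"
    by (simp add: pderiv_prod poly_sum poly_prod pderiv_pCons)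
  also have "\<dots> = (\<Sum>k<n. if k = i then \<Prod>j\<in>{..<n} - {i}. x i - x j else 0)"
    using assms(5) by (intro sum.cong) (auto intro!: prod_zero)
  also have "\<dots> = (\<Prod>j\<in>{..<n} - {i}. x i - x j)" using assms(5) by simp
  finally show ?thesis ..
qed

context valued
begin

context
  fixes a d z :: 'a and r :: nat
  assumes r: "prime r" "odd r"
    and z: "z ^ r = 1" "z \<noteq> 1"
    and a: "a \<noteq> 0" and d: "d \<noteq> 0" and a_power: "a ^ r \<noteq> inverse a ^ r"
begin

text \<open>With \<open>d\<close>, \<open>a\<close>, \<open>z\<close> in the roles of \<delta>,
  \<open>\<alpha>\<^sub>0\<close>, \<zeta>, these are the roots of the Dickson polynomial plus a
  constant.\<close>

abbreviation (input) conjugate :: "nat \<Rightarrow> 'a" where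
  "conjugate i \<equiv> d * (z ^ i * a + inverse (z ^ i * a))"

lemma z_neq_0: "z \<noteq> 0"
  using z r(2) by (auto simp: power_0_left split: if_splits)

lemma z_power_power: "(z ^ i) ^ r = 1"
  by (metis mult.commute power_mult power_one z(1))

text \<open>Each conjugate is a sum of two terms with product \<open>d\<^sup>2\<close>, whose
  \<open>r\<close>-th powers no longer involve \<open>z\<close>. This is the form that
  \<open>poly_dickson\<close> and \<open>poly_dickson2\<close> require.\<close>

lemma cj_eq: "conjugate i = d * (z ^ i * a) + d * inverse (z ^ i * a)"
  "d * (z ^ i * a) * (d * inverse (z ^ i * a)) = d\<^sup>2"
  "(d * (z ^ i * a)) ^ r = d ^ r * a ^ r" "(d * inverse (z ^ i * a)) ^ r = d ^ r * inverse a ^ r"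
  using a z_neq_0 z_power_power[of i]
  by (simp_all add: algebra_simps power2_eq_square power_mult_distrib power_inverse)

lemma poly_dickson_conjugate: "poly (dickson (d\<^sup>2) r) (conjugate i) = d ^ r * (a ^ r + inverse a ^ r)"
  using poly_dickson[of "d * (z ^ i * a)" "d * inverse (z ^ i * a)" r]
  unfolding cj_eq(2-4) cj_eq(1)[symmetric] by (simp add: distrib_left)

lemma poly_dickson2_conjugate:
  "(d * (z ^ i * a) - d * inverse (z ^ i * a)) * poly (dickson2 (d\<^sup>2) (r - 1)) (conjugate i) =
    d ^ r * (a ^ r - inverse a ^ r)"
proof -
  have "Suc (r - 1) = r" using r(2) by (cases r) auto
  then show ?thesis
    using poly_dickson2[of "d * (z ^ i * a)" "d * inverse (z ^ i * a)" "r - 1"]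
    unfolding cj_eq(2) cj_eq(1)[symmetric] by (simp only: cj_eq(3,4) right_diff_distrib)
qed

text \<open>A difference of conjugates factors, and vanishing of the factor that contains
  \<open>a\<close> would give \<open>a ^ r = inverse a ^ r\<close>.\<close>

lemma inj_conjugate: "inj_on conjugate {..<r}"
proof (rule inj_onI)
  fix i j assume ij: "i \<in> {..<r}" "j \<in> {..<r}" "conjugate i = conjugate j"
  have "conjugate i - conjugate j = d * ((z ^ i - z ^ j) * (a - inverse (z ^ (i + j) * a)))"
    using a z_neq_0 by (simp add: field_simps power_add)
  then have "z ^ i = z ^ j \<or> a = inverse (z ^ (i + j) * a)" using ij(3) d by simp
  moreover have False if "a = inverse (z ^ (i + j) * a)"
  proof -
    have "a ^ r = inverse (z ^ (i + j) * a) ^ r" using that by simp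
    also have "\<dots> = inverse a ^ r"
      using z_power_power[of "i + j"] by (simp add: power_mult_distrib power_inverse)
    finally show False using a_power by simp
  qed
  ultimately show "i = j"
    using roots_of_unity_inj[OF r(1) z] ij(1,2) by (auto simp: inj_on_def)
qed

lemma prod_conjugate_differences:
  assumes "i < r"
  shows "(\<Prod>j\<in>{..<r} - {i}. conjugate i - conjugate j) = of_nat r * poly (dickson2 (d\<^sup>2) (r - 1)) (conjugate i)"
proof -
  have r_Suc: "r = Suc (r - 1)" using r(2) by (cases r) auto
  let ?q = "dickson (d\<^sup>2) r + [:- (d ^ r * (a ^ r + inverse a ^ r)):]"
  have "(\<Prod>j\<in>{..<r} - {i}. conjugate i - conjugate j) = poly (pderiv ?q) (conjugate i)"
  proof (rule prod_root_differences[OF inj_conjugate _ _ _ assms])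
    show "degree ?q \<le> r" by (intro degree_add_le degree_dickson) simp
    show "coeff ?q r = 1" using r(2) coeff_dickson[of r "d\<^sup>2"] by (cases r) auto
    show "poly ?q (conjugate i) = 0" for i
      unfolding poly_add poly_dickson_conjugate by simp
  qed
  also have "pderiv ?q = smult (of_nat r) (dickson2 (d\<^sup>2) (r - 1))"
    using pderiv_dickson[of "d\<^sup>2" "r - 1"] r_Suc by (simp add: pderiv_add pderiv_pCons)
  finally show ?thesis by simp
qed

text \<open>Since \<open>r\<close> is odd, the inverse square of \<open>z\<close> is again an
  \<open>r\<close>-th root of unity other than 1, so its powers are all the roots of X^r -
  1.\<close>

lemma prod_z_factors:
  "(\<Prod>i<r. a\<^sup>2 - (inverse z ^ 2) ^ i) = a ^ r * (a ^ r - inverse a ^ r)"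
proof -
  have "inverse z ^ 2 \<noteq> 1"
  proof
    assume "inverse z ^ 2 = 1"
    then have "z ^ 2 = 1" using z_neq_0 by (simp add: power_inverse)
    obtain k where "r = 2 * k + 1" using r(2) by (elim oddE)
    then have "z ^ r = (z ^ 2) ^ k * z" by (simp add: power_add power_mult)
    then show False using z \<open>z ^ 2 = 1\<close> by simp
  qed
  moreover have "(inverse z ^ 2) ^ r = 1"
    using z(1) by (simp add: power_inverse power_commutes flip: power_mult)
      (metis inverse_1 mult.commute power_mult power_one)
  ultimately have "(\<Prod>i<r. a\<^sup>2 - (inverse z ^ 2) ^ i) = (a\<^sup>2) ^ r - 1"
    using prime_gt_0_nat[OF r(1)] by (intro prod_minus_roots_of_unity roots_of_unity_inj r)
  also have "\<dots> = a ^ r * (a ^ r - inverse a ^ r)"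
    using a by (simp add: right_diff_distrib power2_eq_square flip: power_mult_distrib)
  finally show ?thesis .
qed

text \<open>For fixed i the differences multiply to \<open>of_nat r * E i\<close>, and the product
  of \<open>f i\<close> and \<open>E i\<close> has the constant valuation A = r D + B. By
  \<open>prod_z_factors\<close> the product of all \<open>f i\<close> also has valuation A, so the
  \<open>E i\<close> contribute (r - 1) A in total.\<close>

lemma v_prod_conjugate_differences:
  assumes "v (of_nat r) = 1" "v d = ereal D" "v (a ^ r - inverse a ^ r) = ereal B"
  shows "v (\<Prod>i<r. \<Prod>j\<in>{..<r} - {i}. conjugate i - conjugate j) =
    ereal (real r + (real r - 1) * (real r * D + B))"
proof -
  define A where "A = real r * D + B"
  define f where "f i = d * (z ^ i * a) - d * inverse (z ^ i * a)" for i
  define E where "E i = poly (dickson2 (d\<^sup>2) (r - 1)) (conjugate i)" for i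
  have r0: "r > 0" using r(1) prime_gt_0_nat by blast
  obtain b where b: "v a = ereal b" using a v_real by blast
  have fE: "v (f i * E i) = ereal A" for i
    using poly_dickson2_conjugate[of i] assms(2,3) by (simp add: f_def E_def A_def v_mult v_power)
  have "f i \<noteq> 0" "E i \<noteq> 0" for i
    using fE[of i] by auto
  then have "\<exists>g. v (f i) = ereal g \<and> v (E i) = ereal (A - g)" for i
    using fE[of i] v_real[of "f i"] v_real[of "E i"] unfolding v_mult
    by (metis add_diff_cancel_left' ereal.inject plus_ereal.simps(1))
  then obtain g where g: "\<And>i. v (f i) = ereal (g i)" "\<And>i. v (E i) = ereal (A - g i)" by metis
  have vz: "v (z ^ i) = 0" for i
  proof -
    have "v z = ereal (0 / real r)" using z(1) r0 by (intro v_of_power_eq) (auto simp: zero_ereal_def)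
    then show ?thesis by (simp add: v_power flip: zero_ereal_def)
  qed
  have "v (d * inverse a * z ^ i) = ereal (D - b)" for i
    using assms(2) a b vz by (simp add: v_mult v_inverse)
  then have v_scale: "v (\<Prod>i<r. d * inverse a * z ^ i) = ereal (real r * (D - b))"
    by (simp only: v_prod sum_ereal) simp
  have "(\<Prod>i<r. f i) = (\<Prod>i<r. d * inverse a * z ^ i) * (\<Prod>i<r. a\<^sup>2 - (inverse z ^ 2) ^ i)"
    unfolding prod.distrib[symmetric]
  proof (rule prod.cong)
    fix i
    have "(inverse z ^ 2) ^ i = inverse (z ^ i) * inverse (z ^ i)"
      by (simp add: power_inverse power2_eq_square power_mult_distrib)
    then show "f i = d * inverse a * z ^ i * (a\<^sup>2 - (inverse z ^ 2) ^ i)"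
      using a z_neq_0 by (simp add: f_def field_simps power2_eq_square)
  qed simp
  also have "v \<dots> = ereal (real r * (D - b)) + (ereal (real r * b) + ereal B)"
    unfolding prod_z_factors
    unfolding v_mult[of "prod _ _"] v_scale using assms(3) b by (simp add: v_mult v_power)
  also have "\<dots> = ereal A" by (simp add: A_def algebra_simps)
  finally have "(\<Sum>i<r. g i) = A" by (simp add: v_prod g sum_ereal)
  have "v (\<Prod>i<r. \<Prod>j\<in>{..<r} - {i}. conjugate i - conjugate j) = v (\<Prod>i<r. of_nat r * E i)"
    by (intro arg_cong[of _ _ v] prod.cong) (simp_all only: prod_conjugate_differences E_def lessThan_iff)
  also have "\<dots> = ereal (\<Sum>i<r. 1 + (A - g i))"
    using assms(1) by (simp add: v_prod v_mult g one_ereal_def sum_ereal)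
  also have "(\<Sum>i<r. 1 + (A - g i)) = real r + (real r - 1) * A"
    using \<open>(\<Sum>i<r. g i) = A\<close> by (simp add: sum.distrib sum_subtractf algebra_simps)
  finally show ?thesis by (simp add: A_def)
qed

end

end

subsection \<open>The \<open>p\<close>-adic numbers\<close>

locale padic =
  fixes p :: nat and w :: "'k::field_char_0 \<Rightarrow> ereal"
  assumes prime: "prime p" and padic_numbers: "padic_numbers p w"

sublocale padic \<subseteq> valued w
  using padic_numbers by unfold_locales (simp add: padic_numbers_def)

context padic
begin

lemma w_p: "w (of_nat p) = 1"
  using padic_numbers by (simp add: padic_numbers_def)

lemma complete:
  fixes s :: "nat \<Rightarrow> 'k"
  assumes "\<And>N::real. \<exists>M. \<forall>m\<ge>M. \<forall>n\<ge>M. ereal N \<le> w (s m - s n)"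
  shows "\<exists>l. \<forall>N::real. \<exists>M. \<forall>n\<ge>M. ereal N \<le> w (s n - l)"
proof -
  have "\<forall>s::nat \<Rightarrow> 'k. (\<forall>N::real. \<exists>M. \<forall>m\<ge>M. \<forall>n\<ge>M. ereal N \<le> w (s m - s n)) \<longrightarrow>
      (\<exists>l. \<forall>N::real. \<exists>M. \<forall>n\<ge>M. ereal N \<le> w (s n - l))"
    using padic_numbers unfolding padic_numbers_def by (elim conjE)
  from mp[OF spec[OF this, of s] allI[OF assms]] show ?thesis .
qed

text \<open>If both \<open>p\<close> and \<open>n\<close> had positive valuation, a Bezout relation
  would give 1 positive valuation.\<close>

lemma w_of_int_unit:
  assumes "\<not> int p dvd n"
  shows "w (of_int n) = 0"
proof (rule ccontr)
  assume "w (of_int n) \<noteq> 0"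
  then have pos: "0 < w (of_int n)" using v_of_int_ge[of n] by simp
  have "coprime (int p) n" using assms prime by (simp add: prime_imp_coprime)
  then obtain x y where "x * int p + y * n = 1" using bezout_int[of "int p" n] by auto
  then have "(of_int (x * int p + y * n) :: 'k) = of_int 1" by (rule arg_cong)
  then have "of_int x * of_nat p + of_int y * of_int n = (1 :: 'k)" by simp
  moreover have "0 < w (of_int x * of_nat p + of_int y * of_int n)"
  proof (rule v_add_gt)
    show "0 < w (of_int x * of_nat p)"
      using v_of_int_ge[of x] by (cases "w (of_int x)") (auto simp: v_mult w_p one_ereal_def zero_ereal_def)
    show "0 < w (of_int y * of_int n)"
      using v_of_int_ge[of y] pos
      by (cases "w (of_int y)"; cases "w (of_int n)") (auto simp: v_mult zero_ereal_def)
  qed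
  ultimately show False by simp
qed

lemma w_of_int_multiple: "w (of_int (int p * n)) = 1 + w (of_int n)"
  by (simp add: v_mult w_p)

lemma w_of_int:
  assumes "n \<noteq> 0"
  obtains k :: nat where "w (of_int n) = ereal (real k)"
proof -
  obtain m where m: "n = int p ^ multiplicity (int p) n * m" "\<not> int p dvd m"
    using assms prime by (metis multiplicity_decompose' nat_int not_prime_unit prime_nat_int_transfer)
  have "w (of_int n) = w (of_nat p ^ multiplicity (int p) n * of_int m)"
    by (subst m(1)) simp
  also have "\<dots> = ereal (real (multiplicity (int p) n))"
    using w_of_int_unit[OF m(2)] by (simp add: v_mult v_power w_p)
  finally show ?thesis by (rule that)
qed

text \<open>A rational number sufficiently close to \<open>x\<close> has the same valuation, and the
  valuation of a nonzero rational is a difference of two natural numbers.\<close>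

lemma w_int:
  assumes "x \<noteq> 0"
  shows "\<exists>k::int. w x = ereal (of_int k)"
proof -
  obtain a where a: "w x = ereal a" using v_real assms by blast
  obtain q :: rat where q: "ereal (a + 1) \<le> w (x - of_rat q)"
    using padic_numbers unfolding padic_numbers_def by blast
  have "w (x + - (x - of_rat q)) = w x"
  proof (rule v_add_eq)
    have "ereal a < ereal (a + 1)" by simp
    also note q
    finally show "w x < w (- (x - of_rat q))" by (simp only: v_minus a)
  qed
  then have wq: "w (of_rat q) = ereal a" using a by simp
  obtain m n where mn: "q = Rat.Fract m n" "n > 0" by (cases q) auto
  have "of_rat q = (of_int m / of_int n :: 'k)" using mn by (simp add: of_rat_rat)
  moreover have "m \<noteq> 0" using wq mn by (auto simp: rat_number_collapse)
  moreover obtain k where "w (of_int m) = ereal (real k)" using w_of_int[OF \<open>m \<noteq> 0\<close>] by blast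
  moreover obtain l where "w (of_int n) = ereal (real l)" using w_of_int[of n] mn by blast
  ultimately have "a = of_int (int k - int l)" using wq mn by (simp add: v_divide)
  then show ?thesis using a by blast
qed

text \<open>With the constant coefficient split off, the difference is (a - b) Q(a) + b (Q(a) -
  Q(b)), and \<open>a\<close>, \<open>b\<close> and Q(a) are integral.\<close>

lemma v_poly_diff_ge:
  assumes "0 \<le> w a" "0 \<le> w b"
  shows "w (a - b) \<le> w (poly (map_poly of_int Q) a - poly (map_poly of_int Q) b)"
proof (induction Q)
  case (pCons k Q)
  let ?Q = "map_poly of_int Q :: 'k poly"
  have "poly (map_poly of_int (pCons k Q)) a - poly (map_poly of_int (pCons k Q)) b =
      (a - b) * poly ?Q a + b * (poly ?Q a - poly ?Q b)"
    by (simp add: hom_distribs algebra_simps)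
  also have "w (a - b) \<le> w \<dots>"
    using pCons(2) assms v_poly_of_int_ge[OF assms(1), of Q]
    by (intro v_add_ge) (auto simp: v_mult add_increasing add_increasing2)
  finally show ?case .
qed simp

text \<open>The root is the fixed point of the contraction \<open>y \<mapsto> - (b + p Q(y)) / t\<close>.\<close>

lemma hensel_linear:
  assumes "\<not> int p dvd t"
  shows "\<exists>y::'k. of_int b + of_int t * y + of_nat p * poly (map_poly of_int Q) y = 0"
proof -
  let ?Q = "\<lambda>y. poly (map_poly of_int Q) y :: 'k"
  define \<phi> where "\<phi> y = - ((of_int b + of_nat p * ?Q y) / of_int t)" for y :: 'k
  have t0: "of_int t \<noteq> (0 :: 'k)" using assms by auto
  have wt: "w (of_int t) = 0" using w_of_int_unit[OF assms] .
  have \<phi>_int: "0 \<le> w (\<phi> y)" if "0 \<le> w y" for y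
  proof -
    have "0 \<le> w (of_int b + of_nat p * ?Q y)"
      by (intro v_add_ge v_mult_ge v_of_int_ge v_of_nat_ge v_poly_of_int_ge that)
    then show ?thesis using t0 wt by (simp add: \<phi>_def v_divide)
  qed
  have \<phi>_contr: "1 + w (y - y') \<le> w (\<phi> y - \<phi> y')" if "0 \<le> w y" "0 \<le> w y'" for y y'
  proof -
    have "\<phi> y - \<phi> y' = - (of_nat p * (?Q y - ?Q y') / of_int t)"
      using t0 by (simp add: \<phi>_def field_simps)
    then show ?thesis
      using v_poly_diff_ge[OF that, of Q] t0 wt by (simp add: v_divide v_mult w_p add_left_mono)
  qed
  define s where "s n = (\<phi> ^^ n) 0" for n
  have s_Suc: "s (Suc n) = \<phi> (s n)" for n by (simp add: s_def)
  have s_int: "0 \<le> w (s n)" for n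
    by (induction n) (auto simp: s_Suc \<phi>_int, simp add: s_def)
  have step: "ereal (real n) \<le> w (s (Suc n) - s n)" for n
  proof (induction n)
    case 0
    show ?case using v_diff_ge[OF s_int s_int] by (simp flip: zero_ereal_def)
  next
    case (Suc n)
    have "ereal (real (Suc n)) = 1 + ereal (real n)" by (simp add: one_ereal_def)
    also have "\<dots> \<le> 1 + w (s (Suc n) - s n)" using Suc by (rule add_left_mono)
    also have "\<dots> \<le> w (s (Suc (Suc n)) - s (Suc n))"
      unfolding s_Suc[of "Suc n"] s_Suc[of n] by (metis \<phi>_contr s_Suc s_int)
    finally show ?case .
  qed
  have dist: "ereal (real n) \<le> w (s (n + k) - s n)" for n k
  proof (induction k)
    case (Suc k)
    have "ereal (real n) \<le> w (s (Suc (n + k)) - s (n + k))"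
      using step[of "n + k"] by (rule order_trans[rotated]) simp
    from v_add_ge[OF this Suc] show ?case by simp
  qed simp
  have cauchy: "\<exists>M. \<forall>m\<ge>M. \<forall>n\<ge>M. ereal N \<le> w (s m - s n)" for N :: real
  proof -
    obtain M :: nat where M: "N \<le> real M" using real_arch_simple by blast
    have "ereal N \<le> w (s m - s n)" if "m \<ge> M" "n \<ge> M" for m n
    proof -
      have "ereal (real M) \<le> w ((s m - s M) - (s n - s M))"
        using dist[of M "m - M"] dist[of M "n - M"] that by (intro v_diff_ge[of _ "_ - _" "_ - _"]) auto
      then have "ereal (real M) \<le> w (s m - s n)" by simp
      then show ?thesis using M by (meson ereal_less_eq(3) order_trans)
    qed
    then show ?thesis by blast
  qed
  then obtain l where l: "\<And>N::real. \<exists>M. \<forall>n\<ge>M. ereal N \<le> w (s n - l)"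
    using complete[of s] by blast
  have l_int: "0 \<le> w l"
  proof -
    obtain n where "ereal 0 \<le> w (s n - l)" using l[of 0] by blast
    from v_diff_ge[OF s_int[of n] this[folded zero_ereal_def]] show ?thesis by simp
  qed
  \<comment> \<open>Both \<open>l\<close> and its image are limits of the iterates, hence they are
    equal.\<close>
  have "ereal N \<le> w (\<phi> l - l)" for N
  proof -
    obtain M where M: "\<And>n. n \<ge> M \<Longrightarrow> ereal N \<le> w (s n - l)" using l[of N] by blast
    have "ereal N \<le> w (s M - l)" using M by simp
    also have "\<dots> \<le> 1 + w (s M - l)" by (cases "w (s M - l)") (auto simp: one_ereal_def)
    also have "\<dots> \<le> w (\<phi> (s M) - \<phi> l)" by (intro \<phi>_contr s_int l_int)
    finally have 1: "ereal N \<le> w (s (Suc M) - \<phi> l)" by (simp add: s_Suc)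
    have "ereal N \<le> w (s (Suc M) - l)" by (rule M) simp
    from v_diff_ge[OF this 1] show ?thesis by simp
  qed
  then have "w (\<phi> l - l) = \<infinity>" by (rule ereal_top)
  then have "\<phi> l = l" by simp
  then have "of_int b + of_int t * l + of_nat p * ?Q l = 0"
    using t0 by (simp add: \<phi>_def field_simps)
      (metis add.commute add.left_commute add_eq_0_iff2)
  then show ?thesis by blast
qed

end

subsection \<open>The discriminant of \<open>\<rat>\<^sub>r(\<gamma>\<^sub>0)\<close>\<close>

lemma simple_extension_subset:
  "simple_extension y \<subseteq> simple_extension (y + to_ac c)"
proof
  let ?R = "ring_of_type_algebra :: 'a alg_closure ring"
  fix x assume "x \<in> simple_extension y"
  then show "x \<in> simple_extension (y + to_ac c)"
    unfolding simple_extension_def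
  proof (induction rule: generate_field.induct)
    case (incl h)
    have "y = (y + to_ac c) \<oplus>\<^bsub>?R\<^esub> to_ac (- c)" by (simp add: ring_of_type_algebra_def)
    moreover have "(y + to_ac c) \<oplus>\<^bsub>?R\<^esub> to_ac (- c) \<in>
        generate_field ?R (range to_ac \<union> {y + to_ac c})"
      by (intro generate_field.eng_add generate_field.incl) (use rangeI[of to_ac "- c"] in blast)+
    ultimately have "y \<in> generate_field ?R (range to_ac \<union> {y + to_ac c})" by simp
    then show ?case using incl by (auto intro: generate_field.incl)
  qed (auto intro: generate_field.intros)
qed

lemma simple_extension_shift: "simple_extension (y + to_ac c) = simple_extension y"
  using simple_extension_subset[of y c] simple_extension_subset[of "y + to_ac c" "- c"] by auto

text \<open>The data of the theorem, transported to the algebraic closure of the \<open>r\<close>-adic numbers.\<close>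

locale dickson_setting = padic r w + L: valued v
  for r :: nat and w :: "'k::field_char_0 \<Rightarrow> ereal" and v :: "'k alg_closure \<Rightarrow> ereal" +
  fixes z s d \<sigma> \<tau> a :: "'k alg_closure" and u c :: int and \<nu> :: real
  assumes r5: "r \<ge> 5"
    and v_to_ac: "\<And>x. v (to_ac x) = w x"
    and z: "z ^ r = 1" "z \<noteq> 1"
    and d: "d \<noteq> 0" "d\<^sup>2 = of_int u" "d ^ r * (2 - 4 * s) = of_int c"
    and sqrts: "\<sigma>\<^sup>2 = s" "\<tau>\<^sup>2 = s - 1"
    and a_power: "a ^ r = 2 * s - 1 + 2 * (\<sigma> * \<tau>)"
    and v_s: "v (s * (s - 1)) = ereal \<nu>"
begin

lemma r_odd: "odd r"
  using prime r5 prime_odd_nat by force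

lemma r_Suc: "Suc (r - 1) = r"
  using r5 by simp

lemma v_of_int: "v (of_int n) = w (of_int n)"
  by (metis to_ac_of_int v_to_ac)

lemma v_r: "v (of_nat r) = 1"
  using v_of_int[of "int r"] w_p by simp

lemma v_2: "v 2 = 0" and v_4: "v 4 = 0"
proof -
  have "\<not> int r dvd 2" "\<not> int r dvd 4" using r5 by (auto dest!: zdvd_imp_le)
  then have "w (of_int 2) = 0" "w (of_int 4) = 0" by (blast intro: w_of_int_unit)+
  then show "v 2 = 0" "v 4 = 0" using v_of_int[of 2] v_of_int[of 4] by simp_all
qed

definition \<gamma> :: "nat \<Rightarrow> 'k alg_closure" where
  "\<gamma> i = d * (z ^ i * a + inverse (z ^ i * a))"

definition D :: real where "D = real_of_ereal (v d)"

lemma v_d: "v d = ereal D"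
proof -
  obtain b where "v d = ereal b" using L.v_real[OF d(1)] by blast
  then show ?thesis by (simp add: D_def)
qed

lemma \<sigma>\<tau>_power2: "(\<sigma> * \<tau>)\<^sup>2 = s * (s - 1)"
  by (simp add: power_mult_distrib sqrts)

lemma v_\<sigma>\<tau>: "v (\<sigma> * \<tau>) = ereal (\<nu> / 2)"
  using L.v_of_power_eq[of 2 "\<sigma> * \<tau>" \<nu>] v_s by (simp add: \<sigma>\<tau>_power2)

text \<open>The numbers 2 s - 1 + 2 \<sigma> \<tau> and 2 s - 1 - 2 \<sigma> \<tau> are inverse to
  each other, their product being (2 s - 1)^2 - 4 s (s - 1) = 1.\<close>

lemma a_neq_0: "a \<noteq> 0" and a_inverse_power: "inverse a ^ r = 2 * s - 1 - 2 * (\<sigma> * \<tau>)"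
proof -
  have "a ^ r * (2 * s - 1 - 2 * (\<sigma> * \<tau>)) = (2 * s - 1)\<^sup>2 - 4 * (\<sigma> * \<tau>)\<^sup>2"
    unfolding a_power by (simp add: power2_eq_square algebra_simps)
  also have "\<dots> = 1"
    unfolding \<sigma>\<tau>_power2 by (simp add: power2_eq_square algebra_simps)
  finally have *: "a ^ r * (2 * s - 1 - 2 * (\<sigma> * \<tau>)) = 1" .
  then show "inverse a ^ r = 2 * s - 1 - 2 * (\<sigma> * \<tau>)"
    unfolding power_inverse by (rule inverse_unique)
  show "a \<noteq> 0" using * r5 by (auto simp: power_0_left)
qed

lemma a_power_diff: "a ^ r - inverse a ^ r = 4 * (\<sigma> * \<tau>)"
  by (simp add: a_power a_inverse_power)

lemma a_power_sum: "a ^ r + inverse a ^ r = 2 * (2 * s - 1)"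
  by (simp add: a_power a_inverse_power)

lemma v_a_power_diff: "v (a ^ r - inverse a ^ r) = ereal (\<nu> / 2)"
  by (simp add: a_power_diff L.v_mult[of 4] v_4 v_\<sigma>\<tau>)

lemma a_power_neq: "a ^ r \<noteq> inverse a ^ r"
  using v_a_power_diff by auto

text \<open>By \<open>g_minus_eq\<close> this is the polynomial of the theorem.\<close>

definition G :: "int poly" where
  "G = dickson u r + [:c:]"

lemma degree_G: "degree G = r" and coeff_G: "coeff G r = 1"
proof -
  show 1: "coeff G r = 1"
    using coeff_dickson[of r u] r5 by (simp add: G_def coeff_eq_0)
  have "degree G \<le> r" unfolding G_def by (intro degree_add_le degree_dickson) simp
  moreover have "r \<le> degree G" using 1 by (intro le_degree) simp
  ultimately show "degree G = r" by simp
qed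

lemma G_root: "poly (map_poly of_int G) (\<gamma> i) = 0"
proof -
  have "poly (map_poly of_int G) (\<gamma> i) = poly (dickson (d\<^sup>2) r) (\<gamma> i) + of_int c"
    by (simp add: G_def hom_distribs map_poly_dickson d(2))
  also have "poly (dickson (d\<^sup>2) r) (\<gamma> i) = d ^ r * (a ^ r + inverse a ^ r)"
    unfolding \<gamma>_def
    by (rule L.poly_dickson_conjugate) (use prime r_odd z a_neq_0 d(1) a_power_neq in auto)
  also have "\<dots> + of_int c = 0"
    by (simp add: a_power_sum d(3)[symmetric] algebra_simps)
  finally show ?thesis .
qed

lemma inj_\<gamma>: "inj_on \<gamma> {..<r}"
  unfolding \<gamma>_def
  by (rule L.inj_conjugate) (use prime r_odd z a_neq_0 d(1) a_power_neq in auto)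

text \<open>Translating the conjugates by \<open>b\<close> changes neither the field nor the
  differences, so \<open>totally_ramified\<close> applies to the translates. The three cases only
  have to supply \<open>b\<close> and \<open>m\<close>.\<close>

lemma v_discriminant_of_valuation:
  fixes m :: nat
  assumes v: "v (\<gamma> 0 + to_ac b) = ereal (real m / real r)" and m: "coprime m r"
  shows "w (discriminant v (simple_extension (\<gamma> 0))) =
    ereal (real r + (real r - 1) * (real r * D + \<nu> / 2 + 1 - real m))"
proof -
  define P where "P = (map_poly of_int G :: 'k poly) \<circ>\<^sub>p [:- b, 1:]"
  have map_P: "map_poly to_ac P = (map_poly of_int G) \<circ>\<^sub>p [:- to_ac b, 1:]"
    by (simp add: P_def hom_distribs map_poly_map_poly o_def)
  interpret totally_ramified v "of_nat r" r m "\<lambda>i. \<gamma> i + to_ac b" P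
  proof
    show "\<exists>k::int. v (to_ac c) = ereal (of_int k)" if "c \<noteq> 0" for c
      unfolding v_to_ac by (rule w_int[OF that])
    show "v (to_ac (of_nat r)) = 1" by (simp add: v_r)
    show "0 < r" using r5 by simp
    show "degree P = r" by (simp add: P_def degree_pcompose degree_G)
    show "poly (map_poly to_ac P) (\<gamma> i + to_ac b) = 0" for i
      by (simp add: map_P poly_pcompose G_root)
    show "inj_on (\<lambda>i. \<gamma> i + to_ac b) {..<r}" using inj_\<gamma> by (simp add: inj_on_def)
  qed (use v m in auto)
  have "v (\<Prod>i<r. \<Prod>j\<in>{..<r} - {i}. \<gamma> i - \<gamma> j) =
      ereal (real r + (real r - 1) * (real r * D + \<nu> / 2))"
    unfolding \<gamma>_def
    by (rule L.v_prod_conjugate_differences)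
      (use prime r_odd z a_neq_0 d(1) a_power_neq v_r v_d v_a_power_diff in auto)
  then have "v (to_ac (discriminant v (simple_extension (\<gamma> 0)))) =
      ereal (real r + (real r - 1) * (real r * D + \<nu> / 2)) - ereal ((real m - 1) * (real r - 1))"
    using v_discriminant by (simp add: simple_extension_shift)
  then show ?thesis unfolding v_to_ac by (simp add: algebra_simps)
qed

lemma \<gamma>_0: "\<gamma> 0 = d * (a + inverse a)"
  by (simp add: \<gamma>_def)

text \<open>This links the rational integer in \<open>dickson2_prime_unit\<close> with the quantity
  in (H2), through (2 - 4 s)^2 - 4 = 16 s (s - 1).\<close>

lemma of_int_discriminant: "of_int (c\<^sup>2 - 4 * u ^ r) = d ^ (2 * r) * (16 * (s * (s - 1)))"
proof -
  have "of_int (c\<^sup>2 - 4 * u ^ r) = (d ^ r * (2 - 4 * s))\<^sup>2 - 4 * (d\<^sup>2) ^ r"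
    by (simp add: d)
  also have "(d\<^sup>2) ^ r = (d ^ r)\<^sup>2" by (simp add: mult.commute flip: power_mult)
  also have "(d ^ r * (2 - 4 * s))\<^sup>2 - 4 * (d ^ r)\<^sup>2 = (d ^ r)\<^sup>2 * (16 * (s * (s - 1)))"
    by (simp add: power2_eq_square algebra_simps)
  finally show ?thesis by (simp add: mult.commute flip: power_mult)
qed

lemma u_neq_0: "u \<noteq> 0"
  using d(1,2) by auto

section \<open>The cases of the theorem\<close>

text \<open>Since \<open>s\<close> is close to 0 or 1, the \<open>r\<close>-th power of
  \<open>a\<close> is close to a sign \<epsilon>, and \<open>y = a - e\<close> turns out to have
  valuation \<nu> / (2 r). Twice that is the valuation of the distance from
  \<open>\<gamma> 0\<close> to 2 \<epsilon> d.\<close>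

lemma discriminant_positive:
  assumes "D = 0" and \<nu>: "\<nu> = real m" "m = 1 \<or> m = 2"
  shows "w (discriminant v (simple_extension (\<gamma> 0))) =
    ereal (real r + (real r - 1) * (1 - real m / 2))"
proof -
  have \<nu>_pos: "0 < \<nu>" "\<nu> \<le> 2" using \<nu> by auto
  \<comment> \<open>Exactly one of \<open>s\<close> and \<open>s - 1\<close> has positive valuation,
    and it carries all of \<nu>; the sign is -1 near 0 and 1 near 1.\<close>
  obtain \<epsilon> :: int where \<epsilon>: "\<epsilon> = 1 \<or> \<epsilon> = - 1" and v_\<epsilon>: "v (2 * s - 1 - of_int \<epsilon>) = ereal \<nu>"
  proof (cases "0 < v s")
    case True
    have "v (- 1 + s) = v (- 1)" using True by (intro L.v_add_eq) simp
    then have "v s = ereal \<nu>" using v_s by (simp add: L.v_mult)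
    then show ?thesis using that[of "- 1"] by (simp add: L.v_mult v_2)
  next
    case False
    have "v s + v (s - 1) = ereal \<nu>" using v_s by (simp add: L.v_mult)
    then have "0 < v (s - 1)"
      using False \<nu>_pos(1) by (cases "v s"; cases "v (s - 1)") (auto simp: zero_ereal_def)
    then have "v (1 + (s - 1)) = v 1" by (intro L.v_add_eq) simp
    then have "v (s - 1) = ereal \<nu>" using v_s by (simp add: L.v_mult)
    moreover have "2 * s - 1 - of_int 1 = 2 * (s - 1)" by simp
    ultimately show ?thesis using that[of 1] by (simp only: L.v_mult v_2) simp
  qed
  define e where "e = (of_int \<epsilon> :: 'k alg_closure)"
  have e: "e * e = 1" "v e = 0" using \<epsilon> by (auto simp: e_def)
  have \<epsilon>_power: "\<epsilon> ^ r = \<epsilon>" using \<epsilon> r_odd by auto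
  have v_2\<sigma>\<tau>: "v (2 * (\<sigma> * \<tau>)) = ereal (\<nu> / 2)" by (simp add: L.v_mult[of 2] v_2 v_\<sigma>\<tau>)
  have "v (2 * (\<sigma> * \<tau>)) < v (2 * s - 1 - e)"
    unfolding v_2\<sigma>\<tau> e_def v_\<epsilon> using \<nu>_pos by simp
  from L.v_add_eq[OF this] have "v (2 * (\<sigma> * \<tau>) + (2 * s - 1 - e)) = ereal (\<nu> / 2)"
    by (simp only: v_2\<sigma>\<tau>)
  moreover have "a ^ r - e = 2 * (\<sigma> * \<tau>) + (2 * s - 1 - e)" by (simp add: a_power)
  ultimately have v_a_e: "v (a ^ r - e) = ereal (\<nu> / 2)" by (simp only:)
  have "v (e + (a ^ r - e)) = v e"
    using v_a_e e(2) \<nu>_pos by (intro L.v_add_eq) (simp add: zero_ereal_def)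
  then have "v (a ^ r) = ereal 0" using e(2) by (simp add: zero_ereal_def)
  then have v_a: "v a = 0" using L.v_of_power_eq[of r a 0] r5 by (simp add: zero_ereal_def)
  define y where "y = a - e"
  have y_int: "0 \<le> v y" unfolding y_def using v_a e(2) by (intro L.v_diff_ge) auto
  \<comment> \<open>In the binomial expansion of (y + \<epsilon>)^r all middle coefficients are
    divisible by \<open>r\<close>.\<close>
  obtain T where T: "[:\<epsilon>, 1:] ^ r = monom 1 r + smult (int r) ([:0, 1:] * T) + [:poly ([:\<epsilon>, 1:] ^ r) 0:]"
  proof (rule poly_deriv_divisible[OF prime])
    show "degree ([:\<epsilon>, 1:] ^ r) \<le> r" by (simp add: degree_power_eq)
    show "coeff ([:\<epsilon>, 1:] ^ r) r = 1" by (rule coeff_linear_power)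
    show "pderiv ([:\<epsilon>, 1:] ^ r) = smult (int r) ([:\<epsilon>, 1:] ^ (r - 1))"
      using pderiv_power_Suc[of "[:\<epsilon>, 1:]" "r - 1"] unfolding r_Suc by (simp add: pderiv_pCons)
  qed blast
  have "a ^ r = poly (map_poly of_int ([:\<epsilon>, 1:] ^ r)) y"
    by (simp add: hom_distribs y_def e_def)
  also have "\<dots> = y ^ r + of_nat r * (y * poly (map_poly of_int T) y) + e"
    by (subst T) (simp add: hom_distribs poly_monom \<epsilon>_power e_def)
  finally have expand: "a ^ r - e = y ^ r + of_nat r * (y * poly (map_poly of_int T) y)" by simp
  have "y \<noteq> 0" using expand v_a_e r5 by (auto simp: power_0_left)
  then obtain b where b: "v y = ereal b" using L.v_real by blast
  have b0: "0 \<le> b" using b y_int by simp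
  have rest: "ereal (1 + b) \<le> v (of_nat r * (y * poly (map_poly of_int T) y))"
    using L.v_poly_of_int_ge[OF y_int, of T] b
    by (cases "v (poly (map_poly of_int T) y)") (auto simp: L.v_mult v_r one_ereal_def)
  \<comment> \<open>Otherwise both terms of the expansion have valuation at least 1 + b, but their
    sum has valuation \<nu> / 2, at most 1. That forces b = 0, where the inequality does
    hold.\<close>
  have "real r * b < 1 + b"
  proof (rule ccontr)
    assume "\<not> real r * b < 1 + b"
    then have "ereal (1 + b) \<le> v (a ^ r - e)"
      unfolding expand using b rest by (intro L.v_add_ge) (auto simp: L.v_power)
    then have "b \<le> 0" using v_a_e \<nu>_pos by simp
    then show False using b0 \<open>\<not> real r * b < 1 + b\<close> by simp
  qed
  then have "v (y ^ r) < v (of_nat r * (y * poly (map_poly of_int T) y))"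
    using b rest by (simp add: L.v_power less_le_trans[of "ereal (real r * b)" "ereal (1 + b)"])
  then have "v (y ^ r) = ereal (\<nu> / 2)" using L.v_add_eq v_a_e unfolding expand by metis
  then have v_y: "v y = ereal (\<nu> / (2 * real r))"
    using L.v_of_power_eq[of r y "\<nu> / 2"] r5 by simp
  txt \<open>\<open>\<gamma>\<^sub>0\<close> is close to \<open>2 \<epsilon> \<delta>\<close>, which need not be rational, but \<open>2 \<delta> (2 s\<^sub>0 - 1)\<close> is rational and even
    closer to \<open>2 \<epsilon> \<delta>\<close>.\<close>
  define k where "k = (r - 1) div 2"
  have r_k: "r = 2 * k + 1" using r_odd by (simp add: k_def)
  \<comment> \<open>From r = 2 k + 1 it follows that \<open>d ^ r\<close> is \<open>d\<close> times
    the \<open>k\<close>-th power of \<open>u\<close>, so this quotient equals d (2 - 4 s) and lies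
    in the base field.\<close>
  define x0 where "x0 = (of_int c / of_int u ^ k :: 'k)"
  have c: "of_int c = d * (d\<^sup>2) ^ k * (2 - 4 * s)"
    unfolding d(3)[symmetric] by (simp add: r_k power_mult)
  have "to_ac x0 = of_int c / of_int u ^ k" by (simp add: x0_def)
  also have "\<dots> = d * (2 - 4 * s)"
    unfolding c d(2) using u_neq_0 by simp
  also have "\<dots> = - (2 * d * (2 * s - 1))" by (simp add: algebra_simps)
  finally have x0: "to_ac x0 = - (2 * d * (2 * s - 1))" .
  \<comment> \<open>The left side is (a - e)^2 / a because e^2 = 1; this doubles the valuation of
    \<open>y\<close>.\<close>
  have yy: "a + inverse a - 2 * e = y * y * inverse a"
    using a_neq_0 e(1) by (simp add: y_def algebra_simps)
  have "\<gamma> 0 + to_ac x0 = d * (y * y * inverse a) + - (2 * d * (2 * s - 1 - e))"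
    unfolding \<gamma>_0 x0 yy[symmetric] by (simp add: algebra_simps)
  moreover have "v (d * (y * y * inverse a)) = ereal (\<nu> / real r)"
    unfolding L.v_mult L.v_inverse[OF a_neq_0] v_d v_y v_a assms(1)
    by (simp add: zero_ereal_def field_simps)
  moreover have "v (- (2 * d * (2 * s - 1 - e))) = ereal \<nu>"
    unfolding L.v_minus using v_d assms(1) v_\<epsilon> v_2 by (simp add: L.v_mult e_def flip: zero_ereal_def)
  moreover have "\<nu> / real r < \<nu>" using \<nu>_pos r5 by (simp add: divide_less_eq)
  ultimately have "v (\<gamma> 0 + to_ac x0) = ereal (real m / real r)"
    using L.v_add_eq[of "d * (y * y * inverse a)" "- (2 * d * (2 * s - 1 - e))"] \<nu>(1) by simp
  moreover have "coprime m r"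
    using \<nu>(2) r_odd by (auto simp: coprime_commute)
  ultimately show ?thesis
    using v_discriminant_of_valuation[of x0 m] assms(1) \<nu>(1) by (simp add: field_simps)
qed

lemma discriminant_negative:
  assumes "\<nu> < 0" and not_multiple: "\<not> (\<exists>k::int. \<nu> = of_int (int r * k))"
  shows "w (discriminant v (simple_extension (\<gamma> 0))) = ereal (2 * real r - 1)"
proof -
  have r0: "real r > 0" using r5 by simp
  have "(2 * s - 1)\<^sup>2 = 4 * (s * (s - 1)) + 1" by (simp add: power2_eq_square algebra_simps)
  moreover have "v (4 * (s * (s - 1))) = ereal \<nu>" by (simp add: L.v_mult[of 4] v_4 v_s)
  ultimately have "v ((2 * s - 1)\<^sup>2) = ereal \<nu>"
    using L.v_add_eq[of "4 * (s * (s - 1))" 1] assms(1) by simp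
  then have v_2s: "v (2 * s - 1) = ereal (\<nu> / 2)"
    using L.v_of_power_eq[of 2 "2 * s - 1" \<nu>] by simp
  then have v_sum: "v (a ^ r + inverse a ^ r) = ereal (\<nu> / 2)"
    unfolding a_power_sum L.v_mult v_2 by simp
  obtain b where b: "v a = ereal b" using L.v_real a_neq_0 by blast
  have vi: "v (inverse a) = ereal (- b)" using b a_neq_0 by (simp add: L.v_inverse)
  \<comment> \<open>The exponent \<open>r\<close> determines the absolute value of \<open>b\<close>
    from \<nu>, and the exponent 1 then gives the valuation of \<open>\<gamma> 0\<close>.\<close>
  have v_power_sum: "v (a ^ k + inverse a ^ k) = ereal (- real k * \<bar>b\<bar>)" if "b \<noteq> 0" "k > 0" for k
  proof (cases "b > 0")
    case True
    have "v (inverse a ^ k + a ^ k) = v (inverse a ^ k)"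
      using True that b vi by (intro L.v_add_eq) (simp add: L.v_power less_trans[of _ 0])
    then show ?thesis using True vi by (simp add: L.v_power add.commute)
  next
    case False
    then have "b < 0" using that by simp
    have "v (a ^ k + inverse a ^ k) = v (a ^ k)"
      using \<open>b < 0\<close> that b vi by (intro L.v_add_eq) (simp add: L.v_power mult_pos_neg)
    then show ?thesis using \<open>b < 0\<close> b by (simp add: L.v_power)
  qed
  have "b \<noteq> 0"
  proof
    assume "b = 0"
    then have "0 \<le> v (a ^ r + inverse a ^ r)"
      using b vi by (intro L.v_add_ge L.v_power_ge) auto
    then show False using v_sum assms(1) by simp
  qed
  then have "\<nu> / 2 = - real r * \<bar>b\<bar>" using v_power_sum[of r] v_sum r0 by simp
  then have "(real r * D + \<nu> / 2) / real r = D + - \<bar>b\<bar>" using r0 by (simp add: field_simps)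
  moreover have "v (a + inverse a) = ereal (- \<bar>b\<bar>)" using v_power_sum[of 1] \<open>b \<noteq> 0\<close> by simp
  ultimately have v_\<gamma>: "v (\<gamma> 0) = ereal ((real r * D + \<nu> / 2) / real r)"
    unfolding \<gamma>_0 L.v_mult v_d by (simp only: plus_ereal.simps)
  have "2 - 4 * s = - (2 * (2 * s - 1))" by (simp add: algebra_simps)
  then have "v (2 - 4 * s) = ereal (\<nu> / 2)" by (simp only: L.v_minus L.v_mult v_2 v_2s) simp
  then have v_c: "v (of_int c) = ereal (real r * D + \<nu> / 2)"
    unfolding d(3)[symmetric] by (simp add: L.v_mult L.v_power v_d)
  then have "c \<noteq> 0" by auto
  then obtain m where "w (of_int c) = ereal (real m)" by (rule w_of_int)
  then have m: "real r * D + \<nu> / 2 = real m" using v_c v_of_int by simp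
  obtain l where "w (of_int u) = ereal (real l)" using w_of_int[OF u_neq_0] by blast
  then have "v (d\<^sup>2) = ereal (real l)" by (simp add: d(2) v_of_int)
  \<comment> \<open>Although \<open>D\<close> may be a half-integer, 2 D is an integer because the
    square of \<open>d\<close> is one. Thus r dividing \<open>m\<close> would make \<nu> = 2 m - 2 r
    D a multiple of \<open>r\<close>.\<close>
  then have l: "2 * D = real l" by (simp add: L.v_power v_d)
  have "\<not> r dvd m"
  proof
    assume "r dvd m"
    then obtain k where "m = r * k" by blast
    then have "\<nu> = 2 * (real r * real k) - real r * (2 * D)" using m by (simp add: algebra_simps)
    then have "\<nu> = of_int (int r * (2 * int k - int l))" unfolding l by (simp add: algebra_simps)
    then show False using not_multiple by blast
  qed
  then have "coprime m r" using prime_imp_coprime[OF prime] by (simp add: coprime_commute)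
  then show ?thesis
    using v_discriminant_of_valuation[of 0 m] v_\<gamma> unfolding m by simp
qed

text \<open>The polynomial \<open>f\<close>, obtained by moving \<open>- c\<close> to the origin,
  has the form X^r + r X T + f(0) with f(0) divisible by \<open>r\<close> and T(0) prime to
  \<open>r\<close>. If \<open>r\<close> squared divided f(0), a root would exist in the base field;
  so f(0) has valuation 1 and, as for an Eisenstein polynomial, the root
  \<open>\<gamma> 0 + of_int c\<close> has valuation 1 / r.\<close>

lemma discriminant_unit:
  assumes unit: "real r * D + \<nu> / 2 = 0" and irred: "irreducible (map_poly of_int G :: 'k poly)"
  shows "w (discriminant v (simple_extension (\<gamma> 0))) = ereal (real r)"
proof -
  have v_16: "v 16 = 0" using L.v_mult[of 4 4] v_4 by simp
  have "v (of_int (c\<^sup>2 - 4 * u ^ r)) = ereal (2 * real r * D + \<nu>)"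
    unfolding of_int_discriminant using v_s
    by (simp only: L.v_mult[of _ "16 * _"] L.v_mult[of 16] L.v_power v_d v_16) simp
  also have "2 * real r * D + \<nu> = 0" using unit by simp
  finally have "w (of_int (c\<^sup>2 - 4 * u ^ r)) = 0" by (simp only: v_of_int zero_ereal_def)
  have not_dvd: "\<not> int r dvd c\<^sup>2 - 4 * u ^ r"
  proof
    assume "int r dvd c\<^sup>2 - 4 * u ^ r"
    then obtain k where "c\<^sup>2 - 4 * u ^ r = int r * k" by blast
    then have "1 + w (of_int k) = 0"
      using \<open>w (of_int (c\<^sup>2 - 4 * u ^ r)) = 0\<close> w_of_int_multiple by metis
    then show False using v_of_int_ge[of k]
      by (cases "w (of_int k)") (auto simp: one_ereal_def zero_ereal_def)
  qed
  have v_d\<sigma>\<tau>: "v (d ^ r * (\<sigma> * \<tau>)) = 0"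
    using unit by (simp add: L.v_mult[of "d ^ r"] L.v_power v_d v_\<sigma>\<tau> zero_ereal_def)
  have half: "0 \<le> v (2 * x ^ r) \<Longrightarrow> 0 \<le> v x" for x
    using L.v_of_power_ge[of r x] r5 by (simp add: L.v_mult v_2)
  have dr: "d ^ r * (4 * s - 2) = - of_int c" using d(3) by (simp add: algebra_simps)
  \<comment> \<open>Twice the \<open>r\<close>-th power is an integer plus 4 times the unit
    \<open>d ^ r * (\<sigma> * \<tau>)\<close>, hence integral; the same works for the inverse of
    \<open>a\<close> with the opposite sign.\<close>
  have "0 \<le> v (d * a)"
  proof (rule half)
    have "2 * (d * a) ^ r = - of_int c + 4 * (d ^ r * (\<sigma> * \<tau>))"
      unfolding dr[symmetric] by (simp add: power_mult_distrib a_power algebra_simps)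
    also have "0 \<le> v \<dots>"
      using L.v_of_int_ge[of c] v_4 v_d\<sigma>\<tau> by (intro L.v_add_ge) (auto simp: L.v_mult[of 4])
    finally show "0 \<le> v (2 * (d * a) ^ r)" .
  qed
  moreover have "0 \<le> v (d * inverse a)"
  proof (rule half)
    have "2 * (d * inverse a) ^ r = - of_int c + - (4 * (d ^ r * (\<sigma> * \<tau>)))"
      unfolding dr[symmetric] by (simp only: power_mult_distrib a_inverse_power) (simp add: algebra_simps)
    also have "0 \<le> v \<dots>"
      using L.v_of_int_ge[of c] v_4 v_d\<sigma>\<tau> by (intro L.v_add_ge) (auto simp: L.v_mult[of 4])
    finally show "0 \<le> v (2 * (d * inverse a) ^ r)" .
  qed
  ultimately have \<gamma>_int: "0 \<le> v (\<gamma> 0)"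
    unfolding \<gamma>_0 distrib_left by (rule L.v_add_ge)
  \<comment> \<open>The point \<open>- c\<close> is the root of \<open>G\<close> modulo
    \<open>r\<close>, because the Dickson polynomial fixes every integer modulo
    \<open>r\<close>.\<close>
  define f where "f = G \<circ>\<^sub>p [:- c, 1:]"
  have "pderiv f = smult (int r) (dickson2 u (r - 1) \<circ>\<^sub>p [:- c, 1:])"
    using pderiv_dickson[of u "r - 1"] unfolding r_Suc
    by (simp add: f_def G_def pderiv_pcompose pderiv_add pderiv_pCons pcompose_smult)
  moreover have deg_f: "degree f = r" by (simp add: f_def degree_pcompose degree_G)
  moreover have "coeff f r = 1"
    using lead_coeff_comp[of "[:- c, 1:]" G] by (simp add: f_def[symmetric] deg_f degree_G coeff_G)
  ultimately obtain T where T: "f = monom 1 r + smult (int r) ([:0, 1:] * T) + [:poly f 0:]"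
      "poly T 0 = poly (dickson2 u (r - 1) \<circ>\<^sub>p [:- c, 1:]) 0"
    using poly_deriv_divisible[OF prime, of f] by (metis order_refl)
  have f_eval: "poly (map_poly of_int f) y = y ^ r + of_nat r * (y * poly (map_poly of_int T) y) + of_int (poly f 0)"
    for y :: "'b :: field_char_0"
    by (subst T(1)) (simp add: hom_distribs poly_monom)
  have f_G: "poly (map_poly of_int f) y = poly (map_poly of_int G) (y - of_int c)" for y :: "'b :: field_char_0"
    by (simp add: f_def hom_distribs poly_pcompose)
  have T0: "\<not> int r dvd poly T 0"
    unfolding T(2) using dickson2_prime_unit[OF prime r_odd not_dvd] by (simp add: poly_pcompose)
  have "poly f 0 = poly (dickson u r) (- c) - (- c)" by (simp add: f_def G_def poly_pcompose)
  then have "int r dvd poly f 0" using dickson_prime_cong[OF prime r_odd, of u "- c"] by simp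
  then obtain f0 where f0: "poly f 0 = int r * f0" by blast
  have "\<not> int r dvd f0"
  proof
    assume "int r dvd f0"
    then obtain b where b: "f0 = int r * b" by blast
    txt \<open>Substituting \<open>X = r Y\<close> and dividing by \<open>r\<^sup>2\<close> leaves a polynomial that is linear modulo \<open>r\<close>.\<close>
    obtain t T2 where tT2: "T = pCons t T2" by (cases T)
    \<comment> \<open>Write T(r Y) = t + r Y T2(r Y). After division by r^2 the leading term is
      r^(r-2) Y^r, so pulling out one more \<open>r\<close> leaves the exponent r - 3, which is a
      genuine difference since r is at least 5.\<close>
    define Q where "Q = monom 1 2 * (T2 \<circ>\<^sub>p [:0, int r:]) + monom (int r ^ (r - 3)) r"
    have "\<not> int r dvd t" using T0 tT2 by simp
    then obtain y :: 'k where y: "of_int b + of_int t * y + of_nat r * poly (map_poly of_int Q) y = 0"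
      using hensel_linear by blast
    have "r = (r - 3) + 3" using r5 by simp
    then have r_pow: "(of_nat r :: 'k) ^ r = of_nat r ^ (r - 3) * of_nat r ^ 3"
      by (metis power_add)
    have "poly (map_poly of_int f) (of_nat r * y) =
        of_nat r ^ 2 * (of_int b + of_int t * y + of_nat r * poly (map_poly of_int Q) y)"
      unfolding f_eval
      by (simp add: f0 b tT2 Q_def hom_distribs poly_pcompose poly_monom power_mult_distrib r_pow
          power2_eq_square power3_eq_cube algebra_simps)
    then have "poly (map_poly of_int G) (of_nat r * y - of_int c) = 0"
      by (simp add: y flip: f_G)
    moreover have "1 < degree (map_poly of_int G :: 'k poly)" using r5 by (simp add: degree_G)
    ultimately show False using root_imp_reducible_poly irred by blast
  qed
  then have v_f0: "v (of_int (poly f 0)) = 1"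
    using w_of_int_multiple[of f0] w_of_int_unit[of f0] by (simp add: f0 v_of_int del: of_int_mult)
  define y where "y = \<gamma> 0 + of_int c"
  have y_int: "0 \<le> v y" unfolding y_def by (intro L.v_add_ge \<gamma>_int L.v_of_int_ge)
  have root: "y ^ r = - (of_int (poly f 0) + of_nat r * (y * poly (map_poly of_int T) y))"
    using f_G[of y] f_eval[of y] G_root[of 0] by (simp add: y_def eq_neg_iff_add_eq_0 algebra_simps)
  have "y \<noteq> 0"
  proof
    assume "y = 0"
  then have "of_int (poly f 0) = (0 :: 'k alg_closure)" using root r5 by (simp add: power_0_left)
    then show False using v_f0 by simp
  qed
  then obtain b where b: "v y = ereal b" using L.v_real by blast
  have b0: "0 \<le> b" using b y_int by simp
  have rest: "ereal (1 + b) \<le> v (of_nat r * (y * poly (map_poly of_int T) y))"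
    using L.v_poly_of_int_ge[OF y_int, of T] b
    by (cases "v (poly (map_poly of_int T) y)") (auto simp: L.v_mult v_r one_ereal_def)
  \<comment> \<open>Both summands of the equation for the power of \<open>y\<close> have valuation
    at least 1, so \<open>b\<close> is positive; then the mixed term exceeds 1 and f(0)
    dominates.\<close>
  have "1 \<le> ereal (1 + b)" using b0 by (simp add: one_ereal_def)
  then have "1 \<le> v (y ^ r)"
    unfolding root L.v_minus using v_f0 order_trans[OF _ rest] by (intro L.v_add_ge) auto
  then have "b > 0" using b b0 r5 by (cases "b = 0") (auto simp: L.v_power)
  then have "(1::ereal) < ereal (1 + b)" by (simp add: one_ereal_def)
  then have "v (y ^ r) = 1"
    unfolding root L.v_minus using v_f0 less_le_trans[OF _ rest] by (subst L.v_add_eq) auto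
  then have "v y = ereal (1 / real r)"
    using L.v_of_power_eq[of r y 1] r5 by (simp add: one_ereal_def)
  then have "v (\<gamma> 0 + to_ac (of_int c)) = ereal (real 1 / real r)" by (simp add: y_def)
  then show ?thesis
    using v_discriminant_of_valuation[of "of_int c" 1] unit by simp
qed

end

subsection \<open>The polynomial \<open>g\<^sub>r\<^sup>-\<close>\<close>

text \<open>Pairing j with 2 k + 1 - j matches each root of unity with its inverse in
  \<open>poly_h_poly\<close>.\<close>

lemma prod_symmetric:
  fixes f :: "nat \<Rightarrow> 'a :: comm_monoid_mult"
  shows "(\<Prod>j<2 * k + 1. f j) = f 0 * (\<Prod>j=1..k. f j * f (2 * k + 1 - j))"
proof -
  have "(\<Prod>j\<in>{k + 1..2 * k}. f j) = (\<Prod>j=1..k. f (2 * k + 1 - j))"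
    by (rule prod.reindex_bij_witness[of _ "\<lambda>j. 2 * k + 1 - j" "\<lambda>j. 2 * k + 1 - j"]) auto
  moreover have "{..<2 * k + 1} = insert 0 ({1..k} \<union> {k + 1..2 * k})" by auto
  moreover have "(\<Prod>j\<in>{1..k} \<union> {k + 1..2 * k}. f j) = (\<Prod>j=1..k. f j) * (\<Prod>j\<in>{k + 1..2 * k}. f j)"
    by (rule prod.union_disjoint) auto
  ultimately show ?thesis by (simp add: prod.distrib)
qed

text \<open>For y = t + 1/t each factor of \<open>h_poly\<close>, up to sign, is (t^2 +
  \<zeta>^j)(t^2 + \<zeta>^(-j)) / t^2, and \<open>y\<close> supplies the factor for j = 0. All
  factors together give (t^(2 r) + 1) / t^r.\<close>

lemma poly_h_poly:
  fixes \<zeta> t :: "'a::field"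
  assumes r: "prime r" "odd r" and \<zeta>: "\<zeta> ^ r = 1" "\<zeta> \<noteq> 1" and t: "t \<noteq> 0"
  defines "y \<equiv> t + inverse t"
  shows "(- 1) ^ ((r - 1) div 2) * (y * poly (h_poly r \<zeta>) (2 - y\<^sup>2)) = t ^ r + inverse t ^ r"
proof -
  define k where "k = (r - 1) div 2"
  have r_k: "r = 2 * k + 1" using r(2) by (simp add: k_def)
  have \<zeta>0: "\<zeta> \<noteq> 0" using \<zeta> r_k by auto
  have inv: "inverse (\<zeta> ^ j) = \<zeta> ^ (r - j)" if "j \<le> k" for j
  proof (rule inverse_unique)
    show "\<zeta> ^ j * \<zeta> ^ (r - j) = 1" using that \<zeta>(1) r_k by (simp flip: power_add)
  qed
  have factor: "- (2 - y\<^sup>2 - (\<zeta> ^ j + inverse (\<zeta> ^ j))) =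
      (t\<^sup>2 + \<zeta> ^ j) * (t\<^sup>2 + \<zeta> ^ (2 * k + 1 - j)) * inverse (t\<^sup>2)" if "j \<le> k" for j
    unfolding r_k[symmetric] inv[OF that, symmetric] y_def using t \<zeta>0
    by (simp add: field_simps power2_eq_square)
  define H where "H = (- 1) ^ k * poly (h_poly r \<zeta>) (2 - y\<^sup>2)"
  have "H = (\<Prod>j=1..k. - (2 - y\<^sup>2 - (\<zeta> ^ j + inverse (\<zeta> ^ j))))"
    unfolding H_def h_poly_def k_def[symmetric] prod_uminus by (simp add: poly_prod algebra_simps)
  also have "\<dots> = (\<Prod>j=1..k. (t\<^sup>2 + \<zeta> ^ j) * (t\<^sup>2 + \<zeta> ^ (2 * k + 1 - j)) * inverse (t\<^sup>2))"
    by (intro prod.cong factor) auto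
  also have "\<dots> = (\<Prod>j=1..k. (t\<^sup>2 + \<zeta> ^ j) * (t\<^sup>2 + \<zeta> ^ (2 * k + 1 - j))) * inverse (t\<^sup>2) ^ k"
    by (simp add: prod.distrib)
  finally have h: "H = (\<Prod>j=1..k. (t\<^sup>2 + \<zeta> ^ j) * (t\<^sup>2 + \<zeta> ^ (2 * k + 1 - j))) * inverse (t\<^sup>2) ^ k" .
  have y: "y = (t\<^sup>2 + \<zeta> ^ 0) * inverse t" using t by (simp add: y_def field_simps power2_eq_square)
  have "y * H = (\<Prod>j<2 * k + 1. t\<^sup>2 + \<zeta> ^ j) * (inverse t * inverse (t\<^sup>2) ^ k)"
    unfolding h y prod_symmetric by (simp only: mult_ac)
  also have "2 * k + 1 = r" by (rule r_k[symmetric])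
  also have "inverse t * inverse (t\<^sup>2) ^ k = inverse t ^ r"
    by (simp add: r_k power_inverse flip: power_mult)
  also have "(\<Prod>j<r. t\<^sup>2 + \<zeta> ^ j) = (\<Prod>j<r. - (- t\<^sup>2 - \<zeta> ^ j))" by (simp add: add.commute)
  also have "\<dots> = (- 1) ^ r * (\<Prod>j<r. - t\<^sup>2 - \<zeta> ^ j)"
    by (simp only: prod_uminus) simp
  also have "(\<Prod>j<r. - t\<^sup>2 - \<zeta> ^ j) = (- t\<^sup>2) ^ r - 1"
    using \<zeta> r r_k by (intro prod_minus_roots_of_unity roots_of_unity_inj) auto
  also have "(- 1) ^ r * ((- t\<^sup>2) ^ r - 1) = (t\<^sup>2) ^ r + 1"
    using r(2) by (simp add: power_minus_odd)
  also have "((t\<^sup>2) ^ r + 1) * inverse t ^ r = t ^ r + inverse t ^ r"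
    using t by (simp add: power_inverse field_simps power2_eq_square flip: power_mult_distrib)
  finally show ?thesis unfolding H_def k_def by (simp only: mult_ac)
qed

text \<open>Over an algebraically closed field every argument divided by \<delta> has the form t +
  1/t, where \<open>poly_h_poly\<close> and \<open>poly_dickson\<close> give the same value.
  Uniqueness of the integer polynomial holds since the integers embed in characteristic 0.\<close>

lemma g_minus_eq:
  fixes \<zeta> \<delta> s :: "'a::{alg_closed_field, field_char_0}"
  assumes r: "prime r" "odd r" and \<zeta>: "\<zeta> ^ r = 1" "\<zeta> \<noteq> 1"
    and \<delta>: "\<delta> \<noteq> 0" "\<delta>\<^sup>2 = of_int u" "\<delta> ^ r * (2 - 4 * s) = of_int c"
  shows "g_minus r \<zeta> \<delta> s = dickson u r + [:c:]"
  unfolding g_minus_def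
proof (rule the_equality)
  show *: "map_poly of_int (dickson u r + [:c:]) = smult (\<delta> ^ r) (g_minus_s r \<zeta> s \<circ>\<^sub>p [:0, 1 / \<delta>:])"
  proof (rule poly_ext)
    fix x
    define y where "y = x / \<delta>"
    obtain t where "poly [:1, - y, 1:] t = 0"
      using alg_closed_imp_poly_has_root[of "[:1, - y, 1:]"] by auto
    then have t: "t * t + 1 = y * t" by (simp add: algebra_simps)
    then have t0: "t \<noteq> 0" by auto
    then have y: "y = t + inverse t" using t by (simp add: field_simps)
    have x: "x = \<delta> * t + \<delta> * inverse t" using \<delta>(1) y by (simp add: y_def field_simps)
    have "\<delta> * t * (\<delta> * inverse t) = of_int u" using t0 by (simp add: \<delta>(2)[symmetric] power2_eq_square)
    then have "poly (dickson (of_int u) r) x = (\<delta> * t) ^ r + (\<delta> * inverse t) ^ r"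
      using poly_dickson[of "\<delta> * t" "\<delta> * inverse t" r] by (simp add: x)
    then have "poly (map_poly of_int (dickson u r + [:c:])) x =
        \<delta> ^ r * (t ^ r + inverse t ^ r) + \<delta> ^ r * (2 - 4 * s)"
      by (simp add: hom_distribs map_poly_dickson \<delta>(3) power_mult_distrib distrib_left)
    also have "\<dots> = \<delta> ^ r * ((- 1) ^ ((r - 1) div 2) * (y * poly (h_poly r \<zeta>) (2 - y\<^sup>2)) + (2 - 4 * s))"
      using poly_h_poly[OF r \<zeta> t0] by (simp add: y distrib_left)
    also have "\<dots> = poly (smult (\<delta> ^ r) (g_minus_s r \<zeta> s \<circ>\<^sub>p [:0, 1 / \<delta>:])) x"
      by (simp add: g_minus_s_def poly_pcompose y_def power2_eq_square algebra_simps)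
    finally show "poly (map_poly of_int (dickson u r + [:c:])) x =
        poly (smult (\<delta> ^ r) (g_minus_s r \<zeta> s \<circ>\<^sub>p [:0, 1 / \<delta>:])) x" .
  qed
  show "H = dickson u r + [:c:]"
    if "map_poly of_int H = smult (\<delta> ^ r) (g_minus_s r \<zeta> s \<circ>\<^sub>p [:0, 1 / \<delta>:])" for H
    using that unfolding *[symmetric] by (simp only: of_int_poly_hom.eq_iff)
qed

theorem theorem4p51:
  fixes r :: nat
    and w :: "'k::field_char_0 \<Rightarrow> ereal"
    and v :: "'k alg_closure \<Rightarrow> ereal"
    and \<iota> :: "rat alg_closure \<Rightarrow> 'k alg_closure"
    and \<zeta> s\<^sub>0 \<delta> \<sigma> \<tau> \<alpha>\<^sub>0 \<gamma>\<^sub>0 :: "rat alg_closure"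
    and \<nu> :: ereal
    and F :: "'k alg_closure set"
  assumes r: "prime r" "r \<ge> 5"
    and Q_r: "padic_numbers r w"
    and v_ext: "valuation v" "\<forall>x. v (to_ac x) = w x"
    and embedding: "field_hom \<iota>"
    and \<zeta>: "\<zeta> ^ r = 1" "\<forall>k. 0 < k \<and> k < r \<longrightarrow> \<zeta> ^ k \<noteq> 1"
    and s\<^sub>0: "s\<^sub>0 \<noteq> 0" "s\<^sub>0 \<noteq> 1"
    and \<delta>: "algebraic_int \<delta>" "\<delta> \<noteq> 0" "\<delta>\<^sup>2 \<in> \<int>" "\<delta> ^ r * (2 - 4 * s\<^sub>0) \<in> \<int>"
    and sqrts: "\<sigma>\<^sup>2 = s\<^sub>0" "\<tau>\<^sup>2 = s\<^sub>0 - 1"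
    and \<alpha>\<^sub>0: "\<alpha>\<^sub>0 ^ r = 2 * s\<^sub>0 - 1 + 2 * (\<sigma> * \<tau>)"
    and \<gamma>\<^sub>0: "\<gamma>\<^sub>0 = \<delta> * (\<alpha>\<^sub>0 + inverse \<alpha>\<^sub>0)"
    and \<nu>: "\<nu> = v (\<iota> (s\<^sub>0 * (s\<^sub>0 - 1)))"
    and H1: "0 \<le> \<nu> \<longrightarrow> v (\<iota> \<delta>) = 0 \<and> (\<exists>k::int. v (\<iota> (2 - 4 * s\<^sub>0)) = ereal (of_int k))"
    and H2: "\<nu> \<le> 0 \<and> (\<exists>k::int. \<nu> = ereal (of_int (int r * k))) \<longrightarrow>
               v (\<iota> (\<delta> ^ (2 * r) * (s\<^sub>0 * (s\<^sub>0 - 1)))) = 0"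
    and F: "F = simple_extension (\<iota> \<gamma>\<^sub>0)"
  shows "(\<nu> = 2 \<longrightarrow> w (discriminant v F) = ereal (real r)) \<and>
         (\<nu> = 1 \<longrightarrow> w (discriminant v F) = ereal ((3 * real r - 1) / 2)) \<and>
         (\<nu> \<le> 0 \<and> (\<exists>k::int. \<nu> = ereal (of_int (int r * k))) \<and>
            irreducible (map_poly of_int (g_minus r \<zeta> \<delta> s\<^sub>0) :: 'k poly) \<longrightarrow>
            w (discriminant v F) = ereal (real r)) \<and>
         (\<nu> < 0 \<and> \<not> (\<exists>k::int. \<nu> = ereal (of_int (int r * k))) \<longrightarrow>
            w (discriminant v F) = ereal (2 * real r - 1))"
proof -
  interpret \<iota>: field_hom \<iota> by (rule embedding)
  have r_odd: "odd r" using r prime_odd_nat[of r] by simp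
  have \<zeta>1: "\<zeta> \<noteq> 1" using \<zeta>(2)[rule_format, of 1] r(2) by simp
  obtain u where u: "\<delta>\<^sup>2 = of_int u" using \<delta>(3) by (elim Ints_cases)
  obtain c where c: "\<delta> ^ r * (2 - 4 * s\<^sub>0) = of_int c" using \<delta>(4) by (elim Ints_cases)
  interpret padic r w by unfold_locales (rule r Q_r)+
  interpret L: valued v by unfold_locales (rule v_ext)
  have "\<iota> (s\<^sub>0 * (s\<^sub>0 - 1)) \<noteq> 0" using s\<^sub>0 by simp
  then obtain n where n: "\<nu> = ereal n" unfolding \<nu> using L.v_real by blast
  \<comment> \<open>All the data are carried along \<iota>, which preserves the defining equations;
    \<nu> is a real number because \<open>s\<^sub>0\<close> is neither 0 nor 1.\<close>
  interpret dickson_setting r w v "\<iota> \<zeta>" "\<iota> s\<^sub>0" "\<iota> \<delta>" "\<iota> \<sigma>" "\<iota> \<tau>" "\<iota> \<alpha>\<^sub>0" u c n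
  proof
    show "\<iota> \<zeta> ^ r = 1" "\<iota> \<zeta> \<noteq> 1" using \<zeta>(1) \<zeta>1 by (simp_all flip: \<iota>.hom_power)
    show "(\<iota> \<delta>)\<^sup>2 = of_int u" using arg_cong[OF u, of \<iota>] by (simp add: hom_distribs)
    show "\<iota> \<delta> ^ r * (2 - 4 * \<iota> s\<^sub>0) = of_int c" using arg_cong[OF c, of \<iota>] by (simp add: hom_distribs)
    show "(\<iota> \<sigma>)\<^sup>2 = \<iota> s\<^sub>0" "(\<iota> \<tau>)\<^sup>2 = \<iota> s\<^sub>0 - 1"
      using arg_cong[OF sqrts(1), of \<iota>] arg_cong[OF sqrts(2), of \<iota>] by (simp_all add: hom_distribs)
    show "\<iota> \<alpha>\<^sub>0 ^ r = 2 * \<iota> s\<^sub>0 - 1 + 2 * (\<iota> \<sigma> * \<iota> \<tau>)"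
      using arg_cong[OF \<alpha>\<^sub>0, of \<iota>] by (simp add: hom_distribs)
    show "v (\<iota> s\<^sub>0 * (\<iota> s\<^sub>0 - 1)) = ereal n" using n \<nu> by (simp add: hom_distribs)
  qed (use r v_ext \<delta>(2) in auto)
  have F_eq: "F = simple_extension (\<gamma> 0)"
    unfolding F \<gamma>\<^sub>0 by (simp add: \<gamma>_0 hom_distribs)
  have G_eq: "g_minus r \<zeta> \<delta> s\<^sub>0 = G"
    unfolding G_def by (rule g_minus_eq[OF r(1) r_odd \<zeta>(1) \<zeta>1 \<delta>(2) u c])
  have D_0: "D = 0" if "0 \<le> \<nu>"
    using H1 that v_d by (simp add: zero_ereal_def)
  show ?thesis
  proof (intro conjI impI)
    assume "\<nu> = 2"
    then have "ereal n = ereal 2" using n by simp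
    then have "n = real 2" by simp
    then show "w (discriminant v F) = ereal (real r)"
      using discriminant_positive[of 2] D_0 n by (simp add: F_eq)
  next
    assume "\<nu> = 1"
    then have "n = real 1" using n by (simp add: one_ereal_def)
    then show "w (discriminant v F) = ereal ((3 * real r - 1) / 2)"
      using discriminant_positive[of 1] D_0 n by (simp add: F_eq field_simps)
  next
    assume *: "\<nu> \<le> 0 \<and> (\<exists>k::int. \<nu> = ereal (of_int (int r * k))) \<and>
      irreducible (map_poly of_int (g_minus r \<zeta> \<delta> s\<^sub>0) :: 'k poly)"
    then have "v (\<iota> (\<delta> ^ (2 * r) * (s\<^sub>0 * (s\<^sub>0 - 1)))) = 0" using H2 by blast
    moreover have "v (\<iota> (\<delta> ^ (2 * r) * (s\<^sub>0 * (s\<^sub>0 - 1)))) = ereal (2 * real r * D + n)"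
      unfolding \<iota>.hom_mult[of "\<delta> ^ (2 * r)"] L.v_mult[of "\<iota> (\<delta> ^ (2 * r))"] \<nu>[symmetric] n
      by (simp add: hom_distribs L.v_power v_d)
    \<comment> \<open>(H2) says 2 r D + n = 0, which is twice the hypothesis of
      \<open>discriminant_unit\<close>.\<close>
    ultimately have "real r * D + n / 2 = 0" by (simp add: zero_ereal_def)
    then show "w (discriminant v F) = ereal (real r)"
      using discriminant_unit * by (simp add: F_eq G_eq)
  next
    assume *: "\<nu> < 0 \<and> \<not> (\<exists>k::int. \<nu> = ereal (of_int (int r * k)))"
    then show "w (discriminant v F) = ereal (2 * real r - 1)"
      using discriminant_negative by (simp add: F_eq n)
  qed
qed

end
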